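(* Let $G$ be a compact Lie group, let $f,g\colon X\to Y$ be $G$-maps between $G$-spaces, and let $\bar{\pi}_Y\colon \mathcal{P}(f,g)\to X$, $\bar\pi_Y(x,\gamma)=x$, be the pullback of the path fibration $\pi_Y\colon Y^I\to Y\times Y$ along $(f,g)\colon X\to Y\times Y$. Let $\bar{\pi}_Y'\colon \mathcal{P}(f,g)/G\to X/G$ be the induced map on orbit spaces. Then $$D_G(f,g)\ \ge\ \mathrm{nil}\big(\ker((\bar{\pi}_Y')^* )\big),$$ where $(\bar{\pi}_Y')^*\colon H^*(X/G;R)\to H^*(\mathcal{P}(f,g)/G;R)$ is the induced map in singular cohomology with coefficients in a commutative ring $R$.
   Context: $I=[0,1]$; $Y^I$ is the space of paths in $Y$ with action $(g\gamma)(t)=g\gamma(t)$; $\pi_Y(\gamma)=(\gamma(0),\gamma(1))$; products carry the diagonal action. Explicitly, $\mathcal{P}(f,g)=\{(x,\gamma)\in X\times Y^I\mid f(x)=\gamma(0),\ g(x)=\gamma(1)\}$. Nilpotency: for an ideal $\mathcal J$ of a cohomology ring, $\mathrm{nil}(\mathcal J)$ is the largest integer $k\ge0$ for which there exist $k$ elements of $\mathcal J$ with nonzero cup product ($\infty$ if there is no largest). Equivariant homotopic distance: $D_G(f,g)$ is the least integer $n\ge 0$ such that $X$ has an open cover $\{U_0,\dots,U_n\}$ by $G$-invariant open sets with $f|_{U_i}\simeq_G g|_{U_i}$ ($G$-homotopic) for all $0\le i\le n$; it is $\infty$ if no such $n$ exists. *)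

theory Defs
  imports
    "HOL-Analysis.Analysis"
    "HOL-Homology.Homology"
    "HOL-Algebra.Group_Action"
    "HOL-Algebra.QuotRing"
    "HOL-Library.Extended_Nat"
begin

section \<open>Compact Lie groups\<close>

text \<open>
  Smoothness is phrased on \<^term>\<open>Euclidean_space n\<close>, the functions \<^typ>\<open>nat \<Rightarrow> real\<close> that vanish
  from index \<^term>\<open>n\<close> on, and not on a type of class \<^class>\<open>euclidean_space\<close>: that class excludes
  dimension 0, hence finite groups.
\<close>

definition partial_deriv :: "nat \<Rightarrow> ((nat \<Rightarrow> real) \<Rightarrow> real) \<Rightarrow> (nat \<Rightarrow> real) \<Rightarrow> real" where
  "partial_deriv i F x = deriv (\<lambda>t. F (x(i := t))) (x i)"

text \<open>\<open>times_cont_diff n k S F\<close>: \<open>F\<close> is of class \<open>C\<^sup>k\<close> on the open subset \<open>S\<close> of \<open>\<real>\<^sup>n\<close>.\<close>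

primrec times_cont_diff ::
    "nat \<Rightarrow> nat \<Rightarrow> (nat \<Rightarrow> real) set \<Rightarrow> ((nat \<Rightarrow> real) \<Rightarrow> real) \<Rightarrow> bool" where
  "times_cont_diff n 0 S F \<longleftrightarrow>
     continuous_map (subtopology (Euclidean_space n) S) euclideanreal F"
| "times_cont_diff n (Suc k) S F \<longleftrightarrow>
     continuous_map (subtopology (Euclidean_space n) S) euclideanreal F \<and>
     (\<forall>i<n. (\<forall>x\<in>S. (\<lambda>t. F (x(i := t))) field_differentiable at (x i)) \<and>
            times_cont_diff n k S (partial_deriv i F))"

definition smooth_map ::
    "nat \<Rightarrow> nat \<Rightarrow> (nat \<Rightarrow> real) set \<Rightarrow> ((nat \<Rightarrow> real) \<Rightarrow> nat \<Rightarrow> real) \<Rightarrow> bool" where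
  "smooth_map m n S F \<longleftrightarrow>
     openin (Euclidean_space m) S \<and> F \<in> S \<rightarrow> topspace (Euclidean_space n) \<and>
     (\<forall>j<n. \<forall>k. times_cont_diff m k S (\<lambda>x. F x j))"

text \<open>A chart is a pair of its domain and its coordinate map.\<close>

type_synonym 'a chart = "'a set \<times> ('a \<Rightarrow> nat \<Rightarrow> real)"

definition is_chart :: "'a topology \<Rightarrow> nat \<Rightarrow> 'a chart \<Rightarrow> bool" where
  "is_chart T n = (\<lambda>(U, c). openin T U \<and> openin (Euclidean_space n) (c ` U) \<and>
     homeomorphic_map (subtopology T U) (subtopology (Euclidean_space n) (c ` U)) c)"

definition smooth_atlas :: "'a topology \<Rightarrow> nat \<Rightarrow> 'a chart set \<Rightarrow> bool" where
  "smooth_atlas T n \<A> \<longleftrightarrow>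
     (\<forall>C\<in>\<A>. is_chart T n C) \<and> (\<Union>C\<in>\<A>. fst C) = topspace T \<and>
     (\<forall>(U, c)\<in>\<A>. \<forall>(V, d)\<in>\<A>. smooth_map n n (c ` (U \<inter> V)) (\<lambda>x. d (inv_into U c x)))"

text \<open>The two projections \<open>\<real>\<^sup>n\<^sup>+\<^sup>n \<rightarrow> \<real>\<^sup>n\<close>; via these, products of charts are charts of the product.\<close>

definition left_coords :: "nat \<Rightarrow> (nat \<Rightarrow> real) \<Rightarrow> nat \<Rightarrow> real" where
  "left_coords n z = (\<lambda>i. if i < n then z i else 0)"

definition right_coords :: "nat \<Rightarrow> (nat \<Rightarrow> real) \<Rightarrow> nat \<Rightarrow> real" where
  "right_coords n z = (\<lambda>i. if i < n then z (n + i) else 0)"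

definition topological_group :: "('g, 'm) monoid_scheme \<Rightarrow> 'g topology \<Rightarrow> bool" where
  "topological_group G T \<longleftrightarrow>
     group G \<and> topspace T = carrier G \<and>
     continuous_map (prod_topology T T) T (\<lambda>(a, b). a \<otimes>\<^bsub>G\<^esub> b) \<and>
     continuous_map T T (\<lambda>a. inv\<^bsub>G\<^esub> a)"

definition lie_group ::
    "('g, 'm) monoid_scheme \<Rightarrow> 'g topology \<Rightarrow> nat \<Rightarrow> 'g chart set \<Rightarrow> bool" where
  "lie_group G T n \<A> \<longleftrightarrow>
     topological_group G T \<and> Hausdorff_space T \<and> second_countable T \<and> smooth_atlas T n \<A> \<and>
     (\<forall>(U, c)\<in>\<A>. \<forall>(V, d)\<in>\<A>. \<forall>(W, e)\<in>\<A>.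
        let m = (\<lambda>z. inv_into U c (left_coords n z) \<otimes>\<^bsub>G\<^esub> inv_into V d (right_coords n z))
        in smooth_map (n + n) n
             {z \<in> topspace (Euclidean_space (n + n)).
                left_coords n z \<in> c ` U \<and> right_coords n z \<in> d ` V \<and> m z \<in> W}
             (\<lambda>z. e (m z))) \<and>
     (\<forall>(U, c)\<in>\<A>. \<forall>(V, d)\<in>\<A>.
        let i = (\<lambda>x. inv\<^bsub>G\<^esub> (inv_into U c x))
        in smooth_map n n {x \<in> c ` U. i x \<in> V} (\<lambda>x. d (i x)))"

definition compact_lie_group :: "('g, 'm) monoid_scheme \<Rightarrow> 'g topology \<Rightarrow> bool" where
  "compact_lie_group G T \<longleftrightarrow> compact_space T \<and> (\<exists>n \<A>. lie_group G T n \<A>)"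


section \<open>Spaces with a group action\<close>

definition G_space ::
    "('g, 'm) monoid_scheme \<Rightarrow> 'g topology \<Rightarrow> 'a topology \<Rightarrow> ('g \<Rightarrow> 'a \<Rightarrow> 'a) \<Rightarrow> bool" where
  "G_space G T X \<alpha> \<longleftrightarrow>
     group_action G (topspace X) \<alpha> \<and> continuous_map (prod_topology T X) X (\<lambda>(a, x). \<alpha> a x)"

definition equivariant_on ::
    "('g, 'm) monoid_scheme \<Rightarrow> ('g \<Rightarrow> 'a \<Rightarrow> 'a) \<Rightarrow> ('g \<Rightarrow> 'b \<Rightarrow> 'b) \<Rightarrow> 'a set \<Rightarrow> ('a \<Rightarrow> 'b) \<Rightarrow> bool" where
  "equivariant_on G \<alpha> \<beta> U h \<longleftrightarrow> (\<forall>a\<in>carrier G. \<forall>x\<in>U. h (\<alpha> a x) = \<beta> a (h x))"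

definition G_map ::
    "('g, 'm) monoid_scheme \<Rightarrow> 'a topology \<Rightarrow> ('g \<Rightarrow> 'a \<Rightarrow> 'a) \<Rightarrow> 'b topology \<Rightarrow> ('g \<Rightarrow> 'b \<Rightarrow> 'b) \<Rightarrow>
     ('a \<Rightarrow> 'b) \<Rightarrow> bool" where
  "G_map G X \<alpha> Y \<beta> h \<longleftrightarrow> continuous_map X Y h \<and> equivariant_on G \<alpha> \<beta> (topspace X) h"

definition invariant_set :: "('g, 'm) monoid_scheme \<Rightarrow> ('g \<Rightarrow> 'a \<Rightarrow> 'a) \<Rightarrow> 'a set \<Rightarrow> bool" where
  "invariant_set G \<alpha> U \<longleftrightarrow> (\<forall>a\<in>carrier G. \<forall>x\<in>U. \<alpha> a x \<in> U)"

text \<open>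
  A \<open>G\<close>-homotopy is a homotopy all of whose stages are equivariant, which is what equivariance of
  \<open>U \<times> I \<rightarrow> Y\<close> means when \<open>G\<close> acts trivially on \<open>I\<close>.
\<close>

definition G_homotopic_on ::
    "('g, 'm) monoid_scheme \<Rightarrow> 'a topology \<Rightarrow> ('g \<Rightarrow> 'a \<Rightarrow> 'a) \<Rightarrow> 'b topology \<Rightarrow> ('g \<Rightarrow> 'b \<Rightarrow> 'b) \<Rightarrow>
     'a set \<Rightarrow> ('a \<Rightarrow> 'b) \<Rightarrow> ('a \<Rightarrow> 'b) \<Rightarrow> bool" where
  "G_homotopic_on G X \<alpha> Y \<beta> U f g \<longleftrightarrow>
     homotopic_with (equivariant_on G \<alpha> \<beta> U) (subtopology X U) Y f g"

definition equivariant_homotopic_distance ::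
    "('g, 'm) monoid_scheme \<Rightarrow> 'a topology \<Rightarrow> ('g \<Rightarrow> 'a \<Rightarrow> 'a) \<Rightarrow> 'b topology \<Rightarrow> ('g \<Rightarrow> 'b \<Rightarrow> 'b) \<Rightarrow>
     ('a \<Rightarrow> 'b) \<Rightarrow> ('a \<Rightarrow> 'b) \<Rightarrow> enat" where
  "equivariant_homotopic_distance G X \<alpha> Y \<beta> f g =
     Inf (enat ` {n. \<exists>U :: nat \<Rightarrow> 'a set.
       (\<forall>i\<le>n. openin X (U i) \<and> invariant_set G \<alpha> (U i) \<and> G_homotopic_on G X \<alpha> Y \<beta> (U i) f g) \<and>
       (\<Union>i\<le>n. U i) = topspace X})"


subsection \<open>Orbit spaces\<close>

definition orbit_space ::
    "('g, 'm) monoid_scheme \<Rightarrow> 'a topology \<Rightarrow> ('g \<Rightarrow> 'a \<Rightarrow> 'a) \<Rightarrow> 'a set topology" where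
  "orbit_space G X \<alpha> = topology (\<lambda>V. V \<subseteq> orbits G (topspace X) \<alpha> \<and>
     openin X {x \<in> topspace X. orbit G \<alpha> x \<in> V})"

lemma openin_orbit_space:
  "openin (orbit_space G X \<alpha>) V \<longleftrightarrow>
     V \<subseteq> orbits G (topspace X) \<alpha> \<and> openin X {x \<in> topspace X. orbit G \<alpha> x \<in> V}"
proof -
  have "istopology (\<lambda>V. V \<subseteq> orbits G (topspace X) \<alpha> \<and> openin X {x \<in> topspace X. orbit G \<alpha> x \<in> V})"
    unfolding istopology_def
  proof (intro conjI allI impI)
    fix S V
    assume "S \<subseteq> orbits G (topspace X) \<alpha> \<and> openin X {x \<in> topspace X. orbit G \<alpha> x \<in> S}"
      and "V \<subseteq> orbits G (topspace X) \<alpha> \<and> openin X {x \<in> topspace X. orbit G \<alpha> x \<in> V}"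
    moreover have "{x \<in> topspace X. orbit G \<alpha> x \<in> S \<inter> V} =
        {x \<in> topspace X. orbit G \<alpha> x \<in> S} \<inter> {x \<in> topspace X. orbit G \<alpha> x \<in> V}" by auto
    ultimately show "S \<inter> V \<subseteq> orbits G (topspace X) \<alpha>"
      and "openin X {x \<in> topspace X. orbit G \<alpha> x \<in> S \<inter> V}" by auto
  next
    fix K
    assume *: "\<forall>V\<in>K. V \<subseteq> orbits G (topspace X) \<alpha> \<and> openin X {x \<in> topspace X. orbit G \<alpha> x \<in> V}"
    then show "\<Union>K \<subseteq> orbits G (topspace X) \<alpha>" by auto
    have "{x \<in> topspace X. orbit G \<alpha> x \<in> \<Union>K} = (\<Union>V\<in>K. {x \<in> topspace X. orbit G \<alpha> x \<in> V})" by auto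
    with * show "openin X {x \<in> topspace X. orbit G \<alpha> x \<in> \<Union>K}" by auto
  qed
  then show ?thesis by (simp add: orbit_space_def)
qed

lemma topspace_orbit_space: "topspace (orbit_space G X \<alpha>) = orbits G (topspace X) \<alpha>"
proof
  show "topspace (orbit_space G X \<alpha>) \<subseteq> orbits G (topspace X) \<alpha>"
    using openin_orbit_space openin_topspace by metis
  have "{x \<in> topspace X. orbit G \<alpha> x \<in> orbits G (topspace X) \<alpha>} = topspace X"
    by (auto simp: orbits_def)
  then have "openin (orbit_space G X \<alpha>) (orbits G (topspace X) \<alpha>)"
    by (simp add: openin_orbit_space)
  then show "orbits G (topspace X) \<alpha> \<subseteq> topspace (orbit_space G X \<alpha>)"
    by (rule openin_subset)
qed

lemma quotient_map_orbit: "quotient_map X (orbit_space G X \<alpha>) (orbit G \<alpha>)"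
  by (auto simp: quotient_map_def topspace_orbit_space openin_orbit_space orbits_def)

text \<open>The image of the orbit of \<open>x\<close> under an equivariant map \<open>h\<close> is the orbit of \<open>h x\<close>.\<close>

definition orbit_map :: "('a \<Rightarrow> 'b) \<Rightarrow> 'a set \<Rightarrow> 'b set" where
  "orbit_map h A = h ` A"


subsection \<open>Paths and the pullback of the path fibration\<close>

text \<open>
  Paths are extensional functions on \<open>[0,1]\<close>, so that equal paths are equal as functions; the
  topology is the compact-open topology.
\<close>

definition path_set :: "'b topology \<Rightarrow> (real \<Rightarrow> 'b) set" where
  "path_set Y = {\<gamma> \<in> extensional {0..1}. continuous_map (top_of_set {0..1}) Y \<gamma>}"

definition path_space :: "'b topology \<Rightarrow> (real \<Rightarrow> 'b) topology" where
  "path_space Y = topology_generated_by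
     {{\<gamma> \<in> path_set Y. \<gamma> ` K \<subseteq> V} | K V. compact K \<and> K \<subseteq> {0..1} \<and> openin Y V}"

lemma topspace_path_space: "topspace (path_space Y) = path_set Y"
proof -
  have "path_set Y \<in> {{\<gamma> \<in> path_set Y. \<gamma> ` K \<subseteq> V} | K V. compact K \<and> K \<subseteq> {0..1} \<and> openin Y V}"
    by (rule CollectI, rule exI[of _ "{}"], rule exI[of _ "{}"]) auto
  then show ?thesis
    unfolding path_space_def topology_generated_by_topspace by blast
qed

definition path_action :: "('g \<Rightarrow> 'b \<Rightarrow> 'b) \<Rightarrow> 'g \<Rightarrow> (real \<Rightarrow> 'b) \<Rightarrow> real \<Rightarrow> 'b" where
  "path_action \<beta> a \<gamma> = (\<lambda>t\<in>{0..1}. \<beta> a (\<gamma> t))"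

definition diagonal_action ::
    "('g \<Rightarrow> 'a \<Rightarrow> 'a) \<Rightarrow> ('g \<Rightarrow> 'b \<Rightarrow> 'b) \<Rightarrow> 'g \<Rightarrow> 'a \<times> 'b \<Rightarrow> 'a \<times> 'b" where
  "diagonal_action \<alpha> \<beta> a = (\<lambda>(x, y). (\<alpha> a x, \<beta> a y))"

definition path_fibration :: "(real \<Rightarrow> 'b) \<Rightarrow> 'b \<times> 'b" where
  "path_fibration \<gamma> = (\<gamma> 0, \<gamma> 1)"

definition path_pullback ::
    "'a topology \<Rightarrow> 'b topology \<Rightarrow> ('a \<Rightarrow> 'b) \<Rightarrow> ('a \<Rightarrow> 'b) \<Rightarrow> ('a \<times> (real \<Rightarrow> 'b)) topology" where
  "path_pullback X Y f g =
     subtopology (prod_topology X (path_space Y)) {(x, \<gamma>). (f x, g x) = path_fibration \<gamma>}"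

definition path_pullback_action ::
    "('g \<Rightarrow> 'a \<Rightarrow> 'a) \<Rightarrow> ('g \<Rightarrow> 'b \<Rightarrow> 'b) \<Rightarrow> 'g \<Rightarrow> 'a \<times> (real \<Rightarrow> 'b) \<Rightarrow> 'a \<times> (real \<Rightarrow> 'b)" where
  "path_pullback_action \<alpha> \<beta> = diagonal_action \<alpha> (path_action \<beta>)"

definition path_pullback_proj :: "'a \<times> (real \<Rightarrow> 'b) \<Rightarrow> 'a" where
  "path_pullback_proj = fst"


section \<open>The singular cohomology ring\<close>

text \<open>
  The coefficient sort \<open>{comm_ring, comm_monoid_mult}\<close> is that of commutative rings with unit; unlike
  \<^class>\<open>comm_ring_1\<close> it does not exclude the zero ring.

  An element of the direct sum of the cochain groups is a family of functions on singular simplices,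
  one for each degree and almost all of them zero. A function on the singular \<open>p\<close>-simplices is
  the same as a homomorphism on the free abelian group over them; it is normalised to be zero
  outside of the singular \<open>p\<close>-simplices of the space.
\<close>

type_synonym ('a, 'r) cochain = "nat \<Rightarrow> ((nat \<Rightarrow> real) \<Rightarrow> 'a) \<Rightarrow> 'r"

definition singular_cochains :: "'a topology \<Rightarrow> ('a, 'r::zero) cochain set" where
  "singular_cochains X =
     {z. (\<forall>p \<sigma>. \<not> singular_simplex p X \<sigma> \<longrightarrow> z p \<sigma> = 0) \<and> finite {p. z p \<noteq> (\<lambda>_. 0)}}"

text \<open>The sum has the signs of \<^const>\<open>chain_boundary\<close>: this is composition with the boundary.\<close>

definition coboundary ::
    "'a topology \<Rightarrow> ('a, 'r::comm_ring) cochain \<Rightarrow> ('a, 'r) cochain" where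
  "coboundary X z = (\<lambda>p \<sigma>.
     if p \<noteq> 0 \<and> singular_simplex p X \<sigma>
     then \<Sum>k\<le>p. (if even k then z (p - 1) (singular_face p k \<sigma>)
                            else - z (p - 1) (singular_face p k \<sigma>))
     else 0)"

text \<open>
  The face spanned by the first \<open>p + 1\<close> vertices, and the one spanned by the last \<open>q + 1\<close> vertices
  of a \<open>(p + q)\<close>-simplex.
\<close>

definition front_face :: "nat \<Rightarrow> ((nat \<Rightarrow> real) \<Rightarrow> 'a) \<Rightarrow> (nat \<Rightarrow> real) \<Rightarrow> 'a" where
  "front_face p \<sigma> = restrict \<sigma> (standard_simplex p)"

definition back_face :: "nat \<Rightarrow> nat \<Rightarrow> ((nat \<Rightarrow> real) \<Rightarrow> 'a) \<Rightarrow> (nat \<Rightarrow> real) \<Rightarrow> 'a" where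
  "back_face p q \<sigma> = (\<lambda>x\<in>standard_simplex q. \<sigma> (\<lambda>i. if i < p then 0 else x (i - p)))"

definition cup ::
    "'a topology \<Rightarrow> ('a, 'r::comm_ring) cochain \<Rightarrow> ('a, 'r) cochain \<Rightarrow> ('a, 'r) cochain" where
  "cup X z w = (\<lambda>n \<sigma>.
     if singular_simplex n X \<sigma>
     then \<Sum>p\<le>n. z p (front_face p \<sigma>) * w (n - p) (back_face p (n - p) \<sigma>)
     else 0)"

definition cocycle_ring ::
    "'a topology \<Rightarrow> ('a, 'r::{comm_ring, comm_monoid_mult}) cochain ring" where
  "cocycle_ring X =
     \<lparr>carrier = {z \<in> singular_cochains X. coboundary X z = (\<lambda>_ _. 0)},
      mult = cup X,
      one = (\<lambda>p \<sigma>. if p = 0 \<and> singular_simplex 0 X \<sigma> then 1 else 0),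
      zero = (\<lambda>_ _. 0),
      add = (\<lambda>z w p \<sigma>. z p \<sigma> + w p \<sigma>)\<rparr>"

definition coboundaries ::
    "'a topology \<Rightarrow> ('a, 'r::{comm_ring, comm_monoid_mult}) cochain set" where
  "coboundaries X = coboundary X ` singular_cochains X"

definition cohomology_ring ::
    "'r::{comm_ring, comm_monoid_mult} itself \<Rightarrow> 'a topology \<Rightarrow> ('a, 'r) cochain set ring" where
  "cohomology_ring R X = cocycle_ring X Quot coboundaries X"

definition cochain_map ::
    "'a topology \<Rightarrow> ('a \<Rightarrow> 'b) \<Rightarrow> ('b, 'r::zero) cochain \<Rightarrow> ('a, 'r) cochain" where
  "cochain_map X h z = (\<lambda>p \<sigma>. if singular_simplex p X \<sigma> then z p (simplex_map p h \<sigma>) else 0)"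

text \<open>
  The map \<open>h\<^sup>* : H\<^sup>*(Y) \<rightarrow> H\<^sup>*(X)\<close> induced by \<open>h : X \<rightarrow> Y\<close>. The union is over representatives \<open>z\<close> of a
  class; all of them give the same class.
\<close>

definition cohomology_map ::
    "'a topology \<Rightarrow> ('a \<Rightarrow> 'b) \<Rightarrow>
     ('b, 'r::{comm_ring, comm_monoid_mult}) cochain set \<Rightarrow> ('a, 'r) cochain set" where
  "cohomology_map X h A = (\<Union>z\<in>A. coboundaries X +>\<^bsub>cocycle_ring X\<^esub> cochain_map X h z)"

text \<open>
  The product of the empty list is \<open>1\<close>. The supremum is the largest element if there is one, and
  \<open>\<infinity>\<close> if there are arbitrarily long nonzero products; it is \<open>0\<close> if there is no nonzero product at
  all, which only happens in the zero ring.
\<close>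

definition nilpotency :: "('c, 'm) ring_scheme \<Rightarrow> 'c set \<Rightarrow> enat" where
  "nilpotency H J =
     Sup {enat (length us) | us. set us \<subseteq> J \<and> foldr (\<lambda>u v. u \<otimes>\<^bsub>H\<^esub> v) us \<one>\<^bsub>H\<^esub> \<noteq> \<zero>\<^bsub>H\<^esub>}"

end

theory Submission
  imports Defs
begin

text \<open>
  A homotopy between the restrictions of \<open>f\<close> and \<open>g\<close> to \<open>U\<close> assigns to each point \<open>x\<close> of \<open>U\<close> a path
  from \<open>f x\<close> to \<open>g x\<close>, that is, a section of the pulled back path fibration over \<open>U\<close>. If \<open>U\<close> is
  invariant and the homotopy equivariant, the section passes to orbits (\<open>orbit_space_section\<close>). A
  cover of \<open>X\<close> by \<open>n + 1\<close> invariant open sets of this kind therefore yields a cover of \<open>X/G\<close> by \<open>n + 1\<close>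
  open sets over which the map \<open>P(f,g)/G \<rightarrow> X/G\<close> has sections.

  What remains is a statement about an arbitrary map \<open>h\<close> from \<open>E\<close> to \<open>B\<close> with sections over the
  sets \<open>V\<^sub>0, \<dots>, V\<^sub>n\<close> of an open cover of \<open>B\<close> (\<open>nilpotency_kernel_le_sections\<close>): a product of
  more than \<open>n\<close> classes in the kernel of \<open>h\<^sup>*\<close> is zero. A class killed by \<open>h\<^sup>*\<close> restricts to zero
  on \<open>V\<^sub>i\<close>, so it is represented by a cocycle that is zero on all simplices in \<open>V\<^sub>i\<close>
  (\<open>cocycle_vanishing_under_section\<close>). With one factor treated in this way for each \<open>i\<close>, the product
  cocycle is zero on every simplex contained in a member of the cover.

  Such a cocycle is a coboundary (\<open>cocycle_zero_on_small_simplices_is_coboundary\<close>), by barycentric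
  subdivision. Arguing with cocycles that vanish on small simplices takes the place of relative
  cohomology and of cup products of pairs. The product in cohomology can be computed on
  representatives because the coboundaries form an ideal in the ring of cocycles, which rests on the Leibniz
  rule (\<open>coboundary_cup\<close>).
\<close>

section \<open>Evaluating cochains on chains\<close>

text \<open>
  The scalar \<open>(-1)\<^sup>k\<close> acting on an additive group. It is an operator rather than a power of \<open>-1\<close>
  because the coefficient ring may be zero, so that its type need not be of class \<^class>\<open>ring_1\<close>.
\<close>

definition alternate :: "nat \<Rightarrow> 'r::ab_group_add \<Rightarrow> 'r" where
  "alternate k x = (if even k then x else - x)"

lemma alternate_0 [simp]: "alternate 0 x = x"
  and alternate_Suc [simp]: "alternate (Suc k) x = - alternate k x"
  and alternate_zero [simp]: "alternate k 0 = 0"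
  and alternate_alternate [simp]: "alternate k (alternate k x) = x"
  by (simp_all add: alternate_def)

lemma alternate_add: "alternate (k + l) x = alternate k (alternate l x)"
  by (simp add: alternate_def)

lemma alternate_commute: "alternate k (alternate l x) = alternate l (alternate k x)"
  by (simp add: alternate_def)

lemma alternate_plus: "alternate k (x + y) = alternate k x + alternate k y"
  by (simp add: alternate_def)

lemma alternate_minus: "alternate k (- x) = - alternate k x"
  by (simp add: alternate_def)

lemma alternate_sum: "alternate k (sum f A) = (\<Sum>a\<in>A. alternate k (f a))"
  by (simp add: alternate_def sum_negf)

lemma alternate_mult_left: "alternate k x * y = alternate k (x * y :: 'r::comm_ring)"
  by (simp add: alternate_def)

lemma alternate_mult_right: "x * alternate k y = alternate k (x * y :: 'r::comm_ring)"
  by (simp add: alternate_def)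

text \<open>
  Chains are the free abelian group over the simplices, so this is its universal property, with the
  additive group of the coefficients as target.
\<close>

lemma additive_extension_exists:
  fixes f :: "'s \<Rightarrow> 'r::ab_group_add"
  shows "\<exists>e. Modules.additive e \<and> (\<forall>s. e (frag_of s) = f s)"
proof -
  define A :: "'r monoid" where "A = \<lparr>carrier = UNIV, mult = (+), one = 0\<rparr>"
  have "comm_group A"
    by (rule comm_groupI) (auto simp: A_def algebra_simps intro: right_minus)
  then interpret A: comm_group A .
  obtain e where e: "e \<in> hom (free_Abelian_group UNIV) A" "\<And>x. x \<in> UNIV \<Longrightarrow> e (frag_of x) = f x"
    using A.free_Abelian_group_universal[of f UNIV] by (auto simp: A_def)
  have "Modules.additive e"
    using e(1) by unfold_locales (auto simp: hom_def A_def)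
  with e(2) show ?thesis by auto
qed

definition cochain_eval :: "('s \<Rightarrow> 'r::ab_group_add) \<Rightarrow> ('s \<Rightarrow>\<^sub>0 int) \<Rightarrow> 'r" where
  "cochain_eval f = (SOME e. Modules.additive e \<and> (\<forall>s. e (frag_of s) = f s))"

interpretation cochain_eval: Modules.additive "cochain_eval f" for f :: "'s \<Rightarrow> 'r::ab_group_add"
  using someI_ex[OF additive_extension_exists[of f]] by (simp add: cochain_eval_def)

lemma cochain_eval_of [simp]: "cochain_eval f (frag_of s) = f s"
  using someI_ex[OF additive_extension_exists[of f]] by (simp add: cochain_eval_def)

lemma cochain_eval_eq_0:
  assumes "\<And>s. s \<in> Poly_Mapping.keys c \<Longrightarrow> f s = 0"
  shows "cochain_eval f c = 0"
  using order_refl[of "Poly_Mapping.keys c"]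
  by (induction rule: frag_induction) (auto simp: assms cochain_eval.diff cochain_eval.zero)

lemma cochain_eval_alternate:
  "cochain_eval f (frag_cmul ((-1) ^ k) c) = alternate k (cochain_eval f c)"
  by (simp add: alternate_def cochain_eval.minus)

lemma coboundary_simplex:
  assumes "singular_simplex (Suc p) X \<sigma>"
  shows "coboundary X z (Suc p) \<sigma> = (\<Sum>k\<le>Suc p. alternate k (z p (singular_face (Suc p) k \<sigma>)))"
  using assms unfolding coboundary_def alternate_def by (simp del: sum.atMost_Suc cong: if_cong)

lemma coboundary_outside: "\<not> singular_simplex p X \<sigma> \<Longrightarrow> coboundary X z p \<sigma> = 0"
  by (simp add: coboundary_def)

lemma coboundary_deg_0: "coboundary X z 0 \<sigma> = 0"
  by (simp add: coboundary_def)

text \<open>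
  The coboundary is the transpose of the boundary. Facts about chains, such as \<open>\<partial>\<partial> = 0\<close> and the
  chain homotopy between subdivision and the identity, are carried over to cochains by this.
\<close>

lemma cochain_eval_coboundary:
  assumes "singular_chain (Suc p) X c"
  shows "cochain_eval (coboundary X z (Suc p)) c = cochain_eval (z p) (chain_boundary (Suc p) c)"
  using assms unfolding singular_chain_def
proof (induction rule: frag_induction)
  case (one \<sigma>)
  then show ?case
    by (simp add: coboundary_simplex chain_boundary_of cochain_eval.sum cochain_eval_alternate
        cochain_eval.add del: sum.atMost_Suc)
qed (auto simp: cochain_eval.diff cochain_eval.zero chain_boundary_diff)

lemma coboundary_coboundary: "coboundary X (coboundary X z) = (\<lambda>_ _. 0)"
proof (intro ext)
  fix p \<sigma>
  show "coboundary X (coboundary X z) p \<sigma> = 0"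
  proof (cases "singular_simplex p X \<sigma> \<and> p \<noteq> 0")
    case True
    then obtain q where q: "p = Suc q" by (meson not0_implies_Suc)
    let ?c = "chain_boundary p (frag_of \<sigma>)"
    have c: "singular_chain p X (frag_of \<sigma>)" using True by (simp add: singular_chain_of)
    have "coboundary X (coboundary X z) p \<sigma> = cochain_eval (coboundary X z q) ?c"
      using cochain_eval_coboundary[of q X "frag_of \<sigma>"] c q by auto
    also have "\<dots> = 0"
    proof (cases q)
      case 0
      then show ?thesis by (simp add: cochain_eval_eq_0 coboundary_deg_0)
    next
      case (Suc r)
      have "cochain_eval (coboundary X z q) ?c = cochain_eval (z r) (chain_boundary q ?c)"
        using singular_chain_boundary[OF c] cochain_eval_coboundary q Suc by fastforce
      also have "\<dots> = 0"
        using chain_boundary_boundary[OF c] q by (simp add: cochain_eval.zero)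
      finally show ?thesis .
    qed
    finally show ?thesis .
  qed (auto simp: coboundary_outside coboundary_deg_0)
qed

section \<open>Cocycles vanishing on small simplices\<close>

definition small_simplex :: "nat \<Rightarrow> 'a topology \<Rightarrow> 'a set set \<Rightarrow> ((nat \<Rightarrow> real) \<Rightarrow> 'a) \<Rightarrow> bool" where
  "small_simplex p X \<V> \<sigma> \<longleftrightarrow> (\<exists>V\<in>\<V>. singular_simplex p (subtopology X V) \<sigma>)"

lemma subdivision_power_chain:
  "singular_chain p X c \<Longrightarrow> singular_chain p X ((singular_subdivision p ^^ i) c)"
  by (induction i) (auto intro: singular_chain_singular_subdivision)

lemma chain_boundary_subdivision_power:
  "singular_chain p X c \<Longrightarrow> chain_boundary p ((singular_subdivision p ^^ i) c) =
     (singular_subdivision (p - Suc 0) ^^ i) (chain_boundary p c)"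
proof (induction i)
  case (Suc i)
  then show ?case
    using chain_boundary_singular_subdivision[OF subdivision_power_chain[OF Suc.prems, of i]] by simp
qed simp

text \<open>
  If \<open>\<partial>h + h\<partial> = S - 1\<close> for a chain map \<open>S\<close>, then \<open>h(1 + S + \<dots> + S\<^bsup>m-1\<^esup>)\<close> is a homotopy from \<open>1\<close> to
  \<open>S\<^sup>m\<close>. These homotopies for different \<open>m\<close> are partial sums of one series, so that a cochain
  vanishing on small simplices sees only finitely many terms of the series on each simplex.
\<close>

lemma telescoped_subdivision_homotopy:
  fixes h :: "nat \<Rightarrow> 'a chain \<Rightarrow> 'a chain"
  assumes h: "\<And>p c. singular_chain p X c \<Longrightarrow>
      chain_boundary (Suc p) (h p c) + h (p - Suc 0) (chain_boundary p c) = singular_subdivision p c - c"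
    and c: "singular_chain p X c"
  shows "chain_boundary (Suc p) (\<Sum>i<m. h p ((singular_subdivision p ^^ i) c)) +
     (\<Sum>i<m. h (p - Suc 0) ((singular_subdivision (p - Suc 0) ^^ i) (chain_boundary p c))) =
     (singular_subdivision p ^^ m) c - c"
proof (induction m)
  case 0 then show ?case by simp
next
  case (Suc m)
  have "chain_boundary (Suc p) (h p ((singular_subdivision p ^^ m) c)) +
      h (p - Suc 0) ((singular_subdivision (p - Suc 0) ^^ m) (chain_boundary p c)) =
      (singular_subdivision p ^^ Suc m) c - (singular_subdivision p ^^ m) c"
    using h[OF subdivision_power_chain[OF c], of m] chain_boundary_subdivision_power[OF c, of m] by simp
  then have "(chain_boundary (Suc p) (\<Sum>i<m. h p ((singular_subdivision p ^^ i) c)) +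
     (\<Sum>i<m. h (p - Suc 0) ((singular_subdivision (p - Suc 0) ^^ i) (chain_boundary p c)))) +
      (chain_boundary (Suc p) (h p ((singular_subdivision p ^^ m) c)) +
      h (p - Suc 0) ((singular_subdivision (p - Suc 0) ^^ m) (chain_boundary p c))) =
      (singular_subdivision p ^^ Suc m) c - c"
    by (subst Suc) simp
  then show ?case by (simp add: chain_boundary_add add_ac)
qed

text \<open>
  Let \<open>S\<close> be barycentric subdivision and \<open>h\<close> a chain homotopy from \<open>1\<close> to \<open>S\<close> that maps chains of
  any subspace to chains of that subspace. A cocycle \<open>z\<close> that vanishes on small simplices is the coboundary of \<open>w(\<sigma>) = - \<Sum>\<^sub>i z(h S\<^sup>i \<sigma>)\<close>. The sum is finite on every
  \<open>\<sigma>\<close>: for large \<open>i\<close> the chain \<open>S\<^sup>i \<sigma>\<close> consists of small simplices by the Lebesgue number lemma,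
  and then so does \<open>h S\<^sup>i \<sigma>\<close>. For a given \<open>\<sigma>\<close>, one bound \<open>m\<close>
  on the summation index serves \<open>\<sigma>\<close> and all of its faces at once, and there the identity
  \<open>\<delta>w(\<sigma>) = z(\<sigma>)\<close> is the homotopy formula evaluated under \<open>z\<close>.
\<close>

theorem cocycle_zero_on_small_simplices_is_coboundary:
  assumes cover: "\<And>V. V \<in> \<V> \<Longrightarrow> openin X V" "topspace X \<subseteq> \<Union>\<V>"
    and z: "z \<in> singular_cochains X" "coboundary X z = (\<lambda>_ _. 0)"
    and small: "\<And>p \<sigma>. small_simplex p X \<V> \<sigma> \<Longrightarrow> z p \<sigma> = 0"
  shows "z \<in> coboundaries X"
proof -
  obtain h :: "nat \<Rightarrow> 'a chain \<Rightarrow> 'a chain" where h0: "\<And>p. h p 0 = 0"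
    and hdiff: "\<And>p c1 c2. h p (c1 - c2) = h p c1 - h p c2"
    and hchain: "\<And>p X c. singular_chain p X c \<Longrightarrow> singular_chain (Suc p) X (h p c)"
    and hbd: "\<And>p X c. singular_chain p X c \<Longrightarrow>
      chain_boundary (Suc p) (h p c) + h (p - Suc 0) (chain_boundary p c) = singular_subdivision p c - c"
    by (rule chain_homotopic_singular_subdivision) blast
  have hz: "cochain_eval (z (Suc p)) (h p c) = 0"
    if "Poly_Mapping.keys c \<subseteq> Collect (small_simplex p X \<V>)" for p c
    using that
  proof (induction rule: frag_induction)
    case (one \<sigma>)
    then obtain V where V: "V \<in> \<V>" "singular_simplex p (subtopology X V) \<sigma>"
      by (auto simp: small_simplex_def)
    then have "singular_chain (Suc p) (subtopology X V) (h p (frag_of \<sigma>))"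
      by (simp add: hchain singular_chain_of)
    then show ?case
      using V(1) by (intro cochain_eval_eq_0 small) (auto simp: small_simplex_def singular_chain_def)
  qed (auto simp: h0 hdiff cochain_eval.zero cochain_eval.diff)
  let ?S = "\<lambda>p i \<sigma>. (singular_subdivision p ^^ i) (frag_of \<sigma>)"
  have ex: "\<exists>n. \<forall>m\<ge>n. Poly_Mapping.keys (?S p m \<sigma>) \<subseteq> Collect (small_simplex p X \<V>)"
    if \<sigma>: "singular_simplex p X \<sigma>" for p \<sigma>
  proof -
    have c: "singular_chain p X (frag_of \<sigma>)" using \<sigma> by (simp add: singular_chain_of)
    show ?thesis
    proof (rule sufficient_iterated_singular_subdivision_exists[OF cover c])
      fix n
      assume n: "\<And>m f. \<lbrakk>n \<le> m; f \<in> Poly_Mapping.keys (?S p m \<sigma>)\<rbrakk>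
        \<Longrightarrow> \<exists>V \<in> \<V>. f \<in> (standard_simplex p) \<rightarrow> V"
      have "small_simplex p X \<V> f" if mf: "n \<le> m" "f \<in> Poly_Mapping.keys (?S p m \<sigma>)" for m f
      proof -
        obtain V where "V \<in> \<V>" "f \<in> standard_simplex p \<rightarrow> V"
          using n[OF mf] by blast
        moreover have "singular_simplex p X f"
          using subdivision_power_chain[OF c, of m] mf(2) by (auto simp: singular_chain_def)
        ultimately show ?thesis
          by (auto simp: small_simplex_def singular_simplex_subtopology)
      qed
      then show ?thesis by blast
    qed
  qed
  then obtain N where N: "\<And>p \<sigma> m. singular_simplex p X \<sigma> \<Longrightarrow> N p \<sigma> \<le> m \<Longrightarrow>
      Poly_Mapping.keys (?S p m \<sigma>) \<subseteq> Collect (small_simplex p X \<V>)"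
    by metis
  define w where "w = (\<lambda>p \<sigma>. if singular_simplex p X \<sigma>
     then - cochain_eval (z (Suc p)) (\<Sum>i<N p \<sigma>. h p (?S p i \<sigma>)) else 0)"
  \<comment> \<open>Truncating later changes nothing, as the extra terms are values of \<open>z\<close> on small chains.\<close>
  have w_stable: "w p \<sigma> = - cochain_eval (z (Suc p)) (\<Sum>i<m. h p (?S p i \<sigma>))"
    if \<sigma>: "singular_simplex p X \<sigma>" and m: "N p \<sigma> \<le> m" for p \<sigma> m
  proof -
    have "cochain_eval (z (Suc p)) (h p (?S p i \<sigma>)) = 0" if "N p \<sigma> \<le> i" for i
      using hz[OF N[OF \<sigma> that]] .
    then have "(\<Sum>i<m. cochain_eval (z (Suc p)) (h p (?S p i \<sigma>))) =
        (\<Sum>i<N p \<sigma>. cochain_eval (z (Suc p)) (h p (?S p i \<sigma>)))"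
      using m by (intro sum.mono_neutral_right) auto
    then show ?thesis using \<sigma> by (simp add: w_def cochain_eval.sum)
  qed
  have "coboundary X w p \<sigma> = z p \<sigma>" for p \<sigma>
  proof (cases "singular_simplex p X \<sigma>")
    case \<sigma>: True
    \<comment> \<open>A common truncation index for \<open>\<sigma>\<close> and all of its faces.\<close>
    define m where "m = Max (insert (N p \<sigma>) ((\<lambda>k. N (p - 1) (singular_face p k \<sigma>)) ` {..p}))"
    have m: "N p \<sigma> \<le> m" "\<And>k. k \<le> p \<Longrightarrow> N (p - 1) (singular_face p k \<sigma>) \<le> m"
      unfolding m_def by (rule Max_ge; simp)+
    have c: "singular_chain p X (frag_of \<sigma>)" using \<sigma> by (simp add: singular_chain_of)
    let ?D = "\<Sum>i<m. h p (?S p i \<sigma>)"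
    let ?E = "\<lambda>c. \<Sum>i<m. h (p - Suc 0) ((singular_subdivision (p - Suc 0) ^^ i) c)"
    have "singular_chain (Suc p) X ?D"
      by (intro singular_chain_sum hchain subdivision_power_chain c)
    then have "cochain_eval (z p) (chain_boundary (Suc p) ?D) = 0"
      using cochain_eval_coboundary[of p X ?D z] z(2) by (simp add: cochain_eval_eq_0)
    moreover have Sm: "cochain_eval (z p) (?S p m \<sigma>) = 0"
      using N[OF \<sigma> m(1)] by (intro cochain_eval_eq_0 small) auto
    have hom: "chain_boundary (Suc p) ?D + ?E (chain_boundary p (frag_of \<sigma>)) = ?S p m \<sigma> - frag_of \<sigma>"
      by (rule telescoped_subdivision_homotopy[of X h, OF _ c]) (rule hbd)
    moreover from arg_cong[OF hom, of "cochain_eval (z p)"] have "cochain_eval (z p) (chain_boundary (Suc p) ?D) +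
        cochain_eval (z p) (?E (chain_boundary p (frag_of \<sigma>))) = cochain_eval (z p) (?S p m \<sigma>) - z p \<sigma>"
      by (simp only: cochain_eval.add cochain_eval.diff cochain_eval_of)
    ultimately have *: "z p \<sigma> = - cochain_eval (z p) (?E (chain_boundary p (frag_of \<sigma>)))"
      using Sm by simp
    show ?thesis
    proof (cases p)
      case 0
      then show ?thesis using * by (simp add: chain_boundary_def h0 coboundary_deg_0 cochain_eval.zero)
    next
      case (Suc q)
      \<comment> \<open>With the truncation index fixed, \<open>w\<close> becomes additive in the simplex and can be evaluated on \<open>\<partial>\<sigma>\<close>.\<close>
      define u where "u = (\<lambda>p \<tau>. - cochain_eval (z (Suc p)) (\<Sum>i<m. h p (?S p i \<tau>)))"
      have "coboundary X w p \<sigma> = (\<Sum>k\<le>p. alternate k (u q (singular_face p k \<sigma>)))"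
        unfolding Suc
      proof (subst coboundary_simplex)
        show "singular_simplex (Suc q) X \<sigma>" using \<sigma> Suc by simp
        show "(\<Sum>k\<le>Suc q. alternate k (w q (singular_face (Suc q) k \<sigma>))) =
          (\<Sum>k\<le>Suc q. alternate k (u q (singular_face (Suc q) k \<sigma>)))"
        proof (intro sum.cong refl arg_cong[of _ _ "alternate _"])
          fix k assume k: "k \<in> {..Suc q}"
          have "singular_simplex q X (singular_face (Suc q) k \<sigma>)"
            using singular_simplex_singular_face[OF \<sigma>, of k] k Suc by simp
          then show "w q (singular_face (Suc q) k \<sigma>) = u q (singular_face (Suc q) k \<sigma>)"
            unfolding u_def using m(2)[of k] k Suc by (intro w_stable) auto
        qed
      qed
      also have "\<dots> = cochain_eval (u q) (chain_boundary p (frag_of \<sigma>))"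
        by (simp add: chain_boundary_of Suc cochain_eval.sum cochain_eval_alternate cochain_eval.add
            del: sum.atMost_Suc)
      also have "\<dots> = - cochain_eval (z p) (?E (chain_boundary p (frag_of \<sigma>)))"
        using order_refl[of "Poly_Mapping.keys (chain_boundary p (frag_of \<sigma>))"]
        by (induction rule: frag_induction)
          (auto simp: u_def Suc h0 hdiff singular_subdivision_power_diff sum_subtractf
             cochain_eval.zero cochain_eval.diff)
      finally show ?thesis using * by simp
    qed
  next
    case False
    with z(1) show ?thesis by (simp add: singular_cochains_def coboundary_outside)
  qed
  then have "z = coboundary X w" by (intro ext) simp
  moreover have "w \<in> singular_cochains X"
  proof -
    have "w p = (\<lambda>_. 0)" if "z (Suc p) = (\<lambda>_. 0)" for p
      by (rule ext) (simp add: w_def that cochain_eval_eq_0)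
    then have "{p. w p \<noteq> (\<lambda>_. 0)} \<subseteq> Suc -` {p. z p \<noteq> (\<lambda>_. 0)}" by auto
    moreover have "finite (Suc -` {p. z p \<noteq> (\<lambda>_. 0)})"
      using z(1) by (intro finite_vimageI) (auto simp: singular_cochains_def)
    ultimately show ?thesis
      by (auto simp: singular_cochains_def w_def dest: finite_subset)
  qed
  ultimately show ?thesis by (auto simp: coboundaries_def)
qed

section \<open>Front and back faces\<close>

text \<open>
  The affine map from the standard \<open>q\<close>-simplex onto the face of the standard \<open>(p + q)\<close>-simplex that is
  spanned by its last \<open>q + 1\<close> vertices; composition with it gives the back face.
\<close>

definition vertex_shift :: "nat \<Rightarrow> (nat \<Rightarrow> real) \<Rightarrow> nat \<Rightarrow> real" where
  "vertex_shift p x = (\<lambda>i. if i < p then 0 else x (i - p))"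

lemma vertex_shift_0 [simp]: "vertex_shift 0 x = x"
  by (simp add: vertex_shift_def)

lemma simplical_face_vertex_shift_le:
  "k \<le> p \<Longrightarrow> simplical_face k (vertex_shift p x) = vertex_shift (Suc p) x"
  by (auto simp: vertex_shift_def simplical_face_def fun_eq_iff)

lemma simplical_face_vertex_shift_add:
  "simplical_face (p + j) (vertex_shift p x) = vertex_shift p (simplical_face j x)"
  by (auto simp: vertex_shift_def simplical_face_def fun_eq_iff intro!: arg_cong[of _ _ x])

lemma vertex_shift_add: "vertex_shift p (vertex_shift q x) = vertex_shift (p + q) x"
  by (auto simp: vertex_shift_def fun_eq_iff intro!: arg_cong[of _ _ x])

lemma simplical_face_beyond:
  "x \<in> standard_simplex p \<Longrightarrow> p < k \<Longrightarrow> simplical_face k x = x"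
  by (auto simp: simplical_face_def fun_eq_iff standard_simplex_def)

lemma simplical_face_in_Suc:
  "k \<le> Suc p \<Longrightarrow> x \<in> standard_simplex p \<Longrightarrow> simplical_face k x \<in> standard_simplex (Suc p)"
  using simplical_face_in_standard_simplex[of "Suc p" k x] by simp

lemma vertex_shift_in_standard_simplex:
  "x \<in> standard_simplex q \<Longrightarrow> vertex_shift p x \<in> standard_simplex (p + q)"
proof (induction p)
  case (Suc p)
  then show ?case
    using simplical_face_vertex_shift_le[of 0 p x, symmetric] simplical_face_in_Suc[of 0 "p + q"] by simp
qed simp

lemma standard_simplex_le: "x \<in> standard_simplex p \<Longrightarrow> p \<le> q \<Longrightarrow> x \<in> standard_simplex q"
  using standard_simplex_mono by blast

lemma back_face_eq: "back_face p q \<sigma> = (\<lambda>x\<in>standard_simplex q. \<sigma> (vertex_shift p x))"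
  by (simp add: back_face_def vertex_shift_def)

lemma singular_face_Suc:
  "singular_face (Suc n) k \<sigma> = (\<lambda>x\<in>standard_simplex n. \<sigma> (simplical_face k x))"
  by (simp add: singular_face_def o_def)

lemma front_face_simplex:
  assumes "singular_simplex n X \<sigma>" "p \<le> n"
  shows "singular_simplex p X (front_face p \<sigma>)"
proof -
  have "continuous_map (subtopology (powertop_real UNIV) (standard_simplex p)) X \<sigma>"
    using assms continuous_map_from_subtopology_mono standard_simplex_mono
    unfolding singular_simplex_def by blast
  then have "continuous_map (subtopology (powertop_real UNIV) (standard_simplex p)) X (front_face p \<sigma>)"
    by (rule continuous_map_eq) (simp add: front_face_def)
  then show ?thesis by (simp add: singular_simplex_def front_face_def)
qed

lemma back_face_0: "singular_simplex n X \<sigma> \<Longrightarrow> back_face 0 n \<sigma> = \<sigma>"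
  by (simp add: back_face_eq singular_simplex_def extensional_restrict)

lemma front_face_self: "singular_simplex n X \<sigma> \<Longrightarrow> front_face n \<sigma> = \<sigma>"
  by (simp add: front_face_def singular_simplex_def extensional_restrict)

text \<open>
  Back faces arise by deleting the first vertex repeatedly, which gives their continuity from that of
  ordinary faces.
\<close>

lemma back_face_Suc: "back_face (Suc p) q \<sigma> = singular_face (Suc q) 0 (back_face p (Suc q) \<sigma>)"
  by (rule ext) (simp add: back_face_eq singular_face_Suc simplical_face_in_Suc
      simplical_face_vertex_shift_add[of p 0, simplified, symmetric] simplical_face_vertex_shift_le)

lemma back_face_simplex:
  "singular_simplex (p + q) X \<sigma> \<Longrightarrow> singular_simplex q X (back_face p q \<sigma>)"
proof (induction p arbitrary: q)
  case 0 then show ?case by (simp add: back_face_0)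
next
  case (Suc p)
  then have "singular_simplex (Suc q) X (back_face p (Suc q) \<sigma>)" by simp
  from singular_simplex_singular_face[OF this, of 0] show ?case by (simp add: back_face_Suc)
qed

text \<open>
  The front \<open>p\<close>-face of the \<open>k\<close>-th face is spanned by the first \<open>p + 1\<close> vertices that remain after
  vertex \<open>k\<close> is deleted. For \<open>k > p\<close> it is the front \<open>p\<close>-face of the whole simplex, and for
  \<open>k \<le> p + 1\<close> it is a face of the front \<open>(p + 1)\<close>-face; both hold for \<open>k = p + 1\<close>. At the back, the
  two descriptions overlap at \<open>k = p\<close>. These overlaps give the terms that cancel in the Leibniz rule.
\<close>

lemma front_face_singular_face_beyond:
  "p < k \<Longrightarrow> p \<le> n \<Longrightarrow> front_face p (singular_face (Suc n) k \<sigma>) = front_face p \<sigma>"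
  by (rule ext) (simp add: front_face_def singular_face_Suc standard_simplex_le simplical_face_beyond)

lemma front_face_singular_face:
  "k \<le> Suc p \<Longrightarrow> p \<le> n \<Longrightarrow>
    front_face p (singular_face (Suc n) k \<sigma>) = singular_face (Suc p) k (front_face (Suc p) \<sigma>)"
  by (rule ext) (simp add: front_face_def singular_face_Suc standard_simplex_le simplical_face_in_Suc)

lemma back_face_singular_face_before:
  "k \<le> p \<Longrightarrow> back_face p q (singular_face (Suc (p + q)) k \<sigma>) = back_face (Suc p) q \<sigma>"
  by (rule ext) (simp add: back_face_eq singular_face_Suc vertex_shift_in_standard_simplex
      simplical_face_vertex_shift_le)

lemma back_face_singular_face:
  "j \<le> Suc q \<Longrightarrow>
    back_face p q (singular_face (Suc (p + q)) (p + j) \<sigma>) = singular_face (Suc q) j (back_face p (Suc q) \<sigma>)"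
  by (rule ext) (simp add: back_face_eq singular_face_Suc vertex_shift_in_standard_simplex
      simplical_face_in_Suc simplical_face_vertex_shift_add)

lemma front_face_front_face: "p \<le> m \<Longrightarrow> front_face p (front_face m \<sigma>) = front_face p \<sigma>"
  by (rule ext) (simp add: front_face_def standard_simplex_le)

lemma back_face_front_face:
  "back_face p q (front_face (p + q) \<sigma>) = front_face q (back_face p (q + r) \<sigma>)"
  by (rule ext) (simp add: front_face_def back_face_eq standard_simplex_le vertex_shift_in_standard_simplex)

lemma back_face_back_face: "back_face q r (back_face p (q + r) \<sigma>) = back_face (p + q) r \<sigma>"
  by (rule ext) (simp add: back_face_eq vertex_shift_in_standard_simplex vertex_shift_add)

section \<open>The cup product of cochains\<close>

lemma cup_simplex:
  "singular_simplex n X \<sigma> \<Longrightarrow>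
     cup X z w n \<sigma> = (\<Sum>p\<le>n. z p (front_face p \<sigma>) * w (n - p) (back_face p (n - p) \<sigma>))"
  by (simp add: cup_def)

lemma cup_outside: "\<not> singular_simplex n X \<sigma> \<Longrightarrow> cup X z w n \<sigma> = 0"
  by (simp add: cup_def)

definition graded_sign :: "('a, 'r::ab_group_add) cochain \<Rightarrow> ('a, 'r) cochain" where
  "graded_sign z = (\<lambda>p \<sigma>. alternate p (z p \<sigma>))"

text \<open>
  The Leibniz rule \<open>\<delta>(z \<union> w) = \<delta>z \<union> w + (-1)\<^sup>p z \<union> \<delta>w\<close> for \<open>z\<close> of degree \<open>p\<close>; the grading sign makes it
  hold for inhomogeneous cochains as well. In the summand of degree \<open>p\<close>, deleting a vertex \<open>k \<le> p\<close>
  changes the front face and deleting \<open>k > p\<close> changes the back face. The right-hand side has two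
  further terms, where the last vertex of the front face or the first vertex of the back face is
  deleted. They are equal up to sign and cancel.
\<close>

theorem coboundary_cup:
  "coboundary X (cup X z w) =
     (\<lambda>n \<sigma>. cup X (coboundary X z) w n \<sigma> + cup X (graded_sign z) (coboundary X w) n \<sigma>)"
proof (intro ext)
  fix m \<sigma>
  show "coboundary X (cup X z w) m \<sigma> =
      cup X (coboundary X z) w m \<sigma> + cup X (graded_sign z) (coboundary X w) m \<sigma>"
  proof (cases "singular_simplex m X \<sigma> \<and> m \<noteq> 0")
    case True
    then obtain n where m: "m = Suc n" by (meson not0_implies_Suc)
    with True have \<sigma>: "singular_simplex (Suc n) X \<sigma>" by simp
    let ?F = "\<lambda>k. singular_face (Suc n) k \<sigma>"
    define A where "A = (\<lambda>p k. z p (singular_face (Suc p) k (front_face (Suc p) \<sigma>)))"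
    define B where "B = (\<lambda>p. w (n - p) (back_face (Suc p) (n - p) \<sigma>))"
    define C where "C = (\<lambda>p. z p (front_face p \<sigma>))"
    define D where "D = (\<lambda>p j. w (n - p) (singular_face (Suc (n - p)) j (back_face p (Suc (n - p)) \<sigma>)))"
    have fr: "z p (front_face p (?F k)) = (if k \<le> p then A p k else C p)"
      if "p \<le> n" for p k
      using that by (simp add: A_def C_def front_face_singular_face front_face_singular_face_beyond)
    have bk: "w (n - p) (back_face p (n - p) (?F k)) = (if k \<le> p then B p else D p (k - p))"
      if "p \<le> n" "k \<le> Suc n" for p k
    proof -
      have "back_face p (n - p) (singular_face (Suc (p + (n - p))) k \<sigma>) = back_face (Suc p) (n - p) \<sigma>"
        if "k \<le> p" using that by (rule back_face_singular_face_before)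
      moreover have "back_face p (n - p) (singular_face (Suc (p + (n - p))) (p + (k - p)) \<sigma>) =
          singular_face (Suc (n - p)) (k - p) (back_face p (Suc (n - p)) \<sigma>)"
        using that by (intro back_face_singular_face) auto
      ultimately show ?thesis using that by (cases "k \<le> p") (simp_all add: B_def D_def)
    qed
    \<comment> \<open>The two overlaps: deleting the last vertex in front, or the first vertex at the back.\<close>
    have AC: "A p (Suc p) = C p" if "p \<le> n" for p
      using front_face_singular_face[of "Suc p" p n \<sigma>] front_face_singular_face_beyond[of p "Suc p" n \<sigma>] that
      by (simp add: A_def C_def)
    have DB: "D p 0 = B p" for p
      by (simp add: D_def B_def back_face_Suc)
    have "coboundary X (cup X z w) m \<sigma> =
        (\<Sum>k\<le>Suc n. alternate k (cup X z w n (?F k)))"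
      unfolding m by (rule coboundary_simplex[OF \<sigma>])
    also have "\<dots> = (\<Sum>k\<le>Suc n. \<Sum>p\<le>n. alternate k
        (z p (front_face p (?F k)) * w (n - p) (back_face p (n - p) (?F k))))"
      using singular_simplex_singular_face[OF \<sigma>]
      by (intro sum.cong refl) (simp add: cup_simplex alternate_sum)
    also have "\<dots> = (\<Sum>p\<le>n. \<Sum>k\<le>Suc n. alternate k
        (z p (front_face p (?F k)) * w (n - p) (back_face p (n - p) (?F k))))"
      by (rule sum.swap)
    also have "\<dots> = (\<Sum>p\<le>n. (\<Sum>k\<le>Suc p. alternate k (A p k)) * B p +
        alternate p (C p) * (\<Sum>j\<le>Suc (n - p). alternate j (D p j)))"
    proof (intro sum.cong refl)
      fix p assume "p \<in> {..n}"
      then have p: "p \<le> n" by simp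
      have "(\<Sum>k\<le>Suc n. alternate k (z p (front_face p (?F k)) * w (n - p) (back_face p (n - p) (?F k)))) =
          (\<Sum>k\<le>Suc n. if k \<le> p then alternate k (A p k * B p) else alternate k (C p * D p (k - p)))"
        using p by (intro sum.cong refl) (simp add: fr bk)
      also have "\<dots> = (\<Sum>k\<in>{..p}. alternate k (A p k * B p)) +
          (\<Sum>k\<in>{Suc p..Suc n}. alternate k (C p * D p (k - p)))"
      proof -
        have "{..Suc n} \<inter> {k. k \<le> p} = {..p}" "{..Suc n} \<inter> - {k. k \<le> p} = {Suc p..Suc n}"
          using p by auto
        then show ?thesis by (subst sum.If_cases) auto
      qed
      also have "(\<Sum>k\<in>{Suc p..Suc n}. alternate k (C p * D p (k - p))) =
          (\<Sum>j\<le>n - p. alternate (p + Suc j) (C p * D p (Suc j)))"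
        using p by (intro sum.reindex_bij_witness[of _ "\<lambda>j. p + Suc j" "\<lambda>k. k - Suc p"])
          (auto simp del: alternate_Suc simp: Suc_diff_Suc)
      also have "(\<Sum>k\<in>{..p}. alternate k (A p k * B p)) =
          (\<Sum>k\<le>Suc p. alternate k (A p k * B p)) + alternate p (C p * D p 0)"
        by (simp add: AC[OF p] DB)
      also have "\<dots> + (\<Sum>j\<le>n - p. alternate (p + Suc j) (C p * D p (Suc j))) =
          (\<Sum>k\<le>Suc p. alternate k (A p k * B p)) + (\<Sum>j\<le>Suc (n - p). alternate (p + j) (C p * D p j))"
        by (simp add: sum.atMost_Suc_shift add.assoc del: sum.atMost_Suc)
      also have "\<dots> = (\<Sum>k\<le>Suc p. alternate k (A p k)) * B p +
        alternate p (C p) * (\<Sum>j\<le>Suc (n - p). alternate j (D p j))"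
        by (simp add: sum_distrib_left sum_distrib_right alternate_mult_left alternate_mult_right
            alternate_add alternate_commute alternate_sum del: sum.atMost_Suc)
      finally show "(\<Sum>k\<le>Suc n. alternate k (z p (front_face p (?F k)) * w (n - p) (back_face p (n - p) (?F k)))) =
        (\<Sum>k\<le>Suc p. alternate k (A p k)) * B p +
        alternate p (C p) * (\<Sum>j\<le>Suc (n - p). alternate j (D p j))" .
    qed
    also have "\<dots> = cup X (coboundary X z) w m \<sigma> + cup X (graded_sign z) (coboundary X w) m \<sigma>"
    proof -
      have "(\<Sum>k\<le>Suc p. alternate k (A p k)) = coboundary X z (Suc p) (front_face (Suc p) \<sigma>)"
        if "p \<le> n" for p
        unfolding A_def using that by (intro coboundary_simplex[symmetric] front_face_simplex[OF \<sigma>]) simp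
      then have "cup X (coboundary X z) w m \<sigma> = (\<Sum>p\<le>n. (\<Sum>k\<le>Suc p. alternate k (A p k)) * B p)"
        using \<sigma> m by (simp add: cup_simplex sum.atMost_Suc_shift[of _ n] coboundary_deg_0 B_def
            del: sum.atMost_Suc)
      moreover
      have "(\<Sum>j\<le>Suc (n - p). alternate j (D p j)) = coboundary X w (Suc (n - p)) (back_face p (Suc (n - p)) \<sigma>)"
        if "p \<le> n" for p
        unfolding D_def using that \<sigma> by (intro coboundary_simplex[symmetric] back_face_simplex) simp
      then have "cup X (graded_sign z) (coboundary X w) m \<sigma> =
          (\<Sum>p\<le>n. alternate p (C p) * (\<Sum>j\<le>Suc (n - p). alternate j (D p j)))"
        using \<sigma> m by (simp add: cup_simplex sum.atMost_Suc[of _ n] coboundary_deg_0 C_def graded_sign_def Suc_diff_le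
            del: sum.atMost_Suc)
      ultimately show ?thesis by (simp add: sum.distrib)
    qed
    finally show ?thesis .
  next
    case False
    then show ?thesis by (auto simp: coboundary_outside coboundary_deg_0 cup_def)
  qed
qed

text \<open>
  Both ways to bracket a triple product sum over the splittings of \<open>n\<close> into three degrees; this
  matches the two orders of summation.
\<close>

lemma sum_triangle_swap:
  fixes f :: "nat \<Rightarrow> nat \<Rightarrow> 'r::comm_monoid_add"
  shows "(\<Sum>m\<le>n. \<Sum>p\<le>m. f p (m - p)) = (\<Sum>p\<le>n. \<Sum>q\<le>n - p. f p q)"
proof -
  have "(\<Sum>m\<le>n. \<Sum>p\<le>m. f p (m - p)) = (\<Sum>(m, p)\<in>(SIGMA m:{..n}. {..m}). f p (m - p))"
    by (rule sum.Sigma) auto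
  also have "\<dots> = (\<Sum>(p, q)\<in>(SIGMA p:{..n}. {..n - p}). f p q)"
    by (rule sum.reindex_bij_witness[of _ "\<lambda>(p, q). (p + q, p)" "\<lambda>(m, p). (p, m - p)"]) auto
  also have "\<dots> = (\<Sum>p\<le>n. \<Sum>q\<le>n - p. f p q)"
    by (rule sum.Sigma[symmetric]) auto
  finally show ?thesis .
qed

lemma cup_assoc: "cup X (cup X a b) c = cup X a (cup X b c)"
proof (intro ext)
  fix n \<sigma>
  show "cup X (cup X a b) c n \<sigma> = cup X a (cup X b c) n \<sigma>"
  proof (cases "singular_simplex n X \<sigma>")
    case \<sigma>: True
    let ?f = "\<lambda>p q. a p (front_face p \<sigma>) * (b q (front_face q (back_face p (n - p) \<sigma>)) *
        c (n - (p + q)) (back_face (p + q) (n - (p + q)) \<sigma>))"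
    have "cup X (cup X a b) c n \<sigma> = (\<Sum>m\<le>n. \<Sum>p\<le>m. ?f p (m - p))"
      unfolding cup_simplex[OF \<sigma>]
    proof (intro sum.cong refl)
      fix m assume m: "m \<in> {..n}"
      have "cup X a b m (front_face m \<sigma>) =
          (\<Sum>p\<le>m. a p (front_face p \<sigma>) * b (m - p) (front_face (m - p) (back_face p (n - p) \<sigma>)))"
        unfolding cup_simplex[OF front_face_simplex[OF \<sigma> m[simplified]]]
      proof (intro sum.cong refl)
        fix p assume "p \<in> {..m}"
        then have "front_face p (front_face m \<sigma>) = front_face p \<sigma>"
          and "back_face p (m - p) (front_face m \<sigma>) = front_face (m - p) (back_face p (n - p) \<sigma>)"
          using m back_face_front_face[of p "m - p" \<sigma> "n - m"] by (auto simp: front_face_front_face)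
        then show "a p (front_face p (front_face m \<sigma>)) * b (m - p) (back_face p (m - p) (front_face m \<sigma>)) =
            a p (front_face p \<sigma>) * b (m - p) (front_face (m - p) (back_face p (n - p) \<sigma>))"
          by simp
      qed
      then show "cup X a b m (front_face m \<sigma>) * c (n - m) (back_face m (n - m) \<sigma>) =
          (\<Sum>p\<le>m. ?f p (m - p))"
        by (simp add: sum_distrib_right mult.assoc)
    qed
    also have "\<dots> = (\<Sum>p\<le>n. \<Sum>q\<le>n - p. ?f p q)"
      by (rule sum_triangle_swap)
    also have "\<dots> = cup X a (cup X b c) n \<sigma>"
      unfolding cup_simplex[OF \<sigma>]
    proof (intro sum.cong refl)
      fix p assume p: "p \<in> {..n}"
      have "singular_simplex (n - p) X (back_face p (n - p) \<sigma>)"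
        using back_face_simplex[of p "n - p"] p \<sigma> by simp
      then have "cup X b c (n - p) (back_face p (n - p) \<sigma>) =
         (\<Sum>q\<le>n - p. b q (front_face q (back_face p (n - p) \<sigma>)) *
            c (n - p - q) (back_face q (n - p - q) (back_face p (n - p) \<sigma>)))"
        by (rule cup_simplex)
      also have "\<dots> = (\<Sum>q\<le>n - p. b q (front_face q (back_face p (n - p) \<sigma>)) *
            c (n - (p + q)) (back_face (p + q) (n - (p + q)) \<sigma>))"
      proof (intro sum.cong refl)
        fix q assume "q \<in> {..n - p}"
        then have "back_face q (n - p - q) (back_face p (n - p) \<sigma>) = back_face (p + q) (n - p - q) \<sigma>"
          using back_face_back_face[of q "n - p - q" p \<sigma>] by (simp del: diff_diff_left)
        then show "b q (front_face q (back_face p (n - p) \<sigma>)) *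
            c (n - p - q) (back_face q (n - p - q) (back_face p (n - p) \<sigma>)) =
          b q (front_face q (back_face p (n - p) \<sigma>)) *
            c (n - (p + q)) (back_face (p + q) (n - (p + q)) \<sigma>)"
          by simp
      qed
      finally show "(\<Sum>q\<le>n - p. ?f p q) = a p (front_face p \<sigma>) * cup X b c (n - p) (back_face p (n - p) \<sigma>)"
        by (simp add: sum_distrib_left)
    qed
    finally show ?thesis .
  qed (simp add: cup_outside)
qed

section \<open>The ring of cocycles and the ideal of coboundaries\<close>

lemma singular_cochainsI:
  assumes "\<And>p \<sigma>. \<not> singular_simplex p X \<sigma> \<Longrightarrow> z p \<sigma> = 0"
    and "finite A" "\<And>p. p \<notin> A \<Longrightarrow> z p = (\<lambda>_. 0)"
  shows "z \<in> singular_cochains X"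
  using assms finite_subset[of "{p. z p \<noteq> (\<lambda>_. 0)}" A] unfolding singular_cochains_def by blast

lemma singular_cochains_outside:
  "z \<in> singular_cochains X \<Longrightarrow> \<not> singular_simplex p X \<sigma> \<Longrightarrow> z p \<sigma> = 0"
  by (simp add: singular_cochains_def)

lemma singular_cochains_finite: "z \<in> singular_cochains X \<Longrightarrow> finite {p. z p \<noteq> (\<lambda>_. 0)}"
  by (simp add: singular_cochains_def)

lemma zero_in_singular_cochains: "(\<lambda>_ _. 0) \<in> singular_cochains X"
  by (rule singular_cochainsI[of _ _ "{}"]) auto

lemma add_in_singular_cochains:
  fixes z w :: "('a, 'r::ab_group_add) cochain"
  assumes "z \<in> singular_cochains X" "w \<in> singular_cochains X"
  shows "(\<lambda>p \<sigma>. z p \<sigma> + w p \<sigma>) \<in> singular_cochains X"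
  using assms
  by (intro singular_cochainsI[of _ _ "{p. z p \<noteq> (\<lambda>_. 0)} \<union> {p. w p \<noteq> (\<lambda>_. 0)}"])
    (auto simp: singular_cochains_outside singular_cochains_finite)

lemma minus_in_singular_cochains:
  fixes z :: "('a, 'r::ab_group_add) cochain"
  assumes "z \<in> singular_cochains X"
  shows "(\<lambda>p \<sigma>. - z p \<sigma>) \<in> singular_cochains X"
  using assms
  by (intro singular_cochainsI[of _ _ "{p. z p \<noteq> (\<lambda>_. 0)}"])
    (auto simp: singular_cochains_outside singular_cochains_finite)

lemma graded_sign_in_singular_cochains:
  assumes "z \<in> singular_cochains X"
  shows "graded_sign z \<in> singular_cochains X"
  using assms
  by (intro singular_cochainsI[of _ _ "{p. z p \<noteq> (\<lambda>_. 0)}"])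
    (auto simp: singular_cochains_outside singular_cochains_finite graded_sign_def)

lemma coboundary_in_singular_cochains:
  assumes "z \<in> singular_cochains X"
  shows "coboundary X z \<in> singular_cochains X"
proof (rule singular_cochainsI)
  show "finite (Suc ` {p. z p \<noteq> (\<lambda>_. 0)})"
    using assms by (simp add: singular_cochains_finite)
  show "coboundary X z p = (\<lambda>_. 0)" if "p \<notin> Suc ` {p. z p \<noteq> (\<lambda>_. 0)}" for p
  proof (cases p)
    case (Suc q)
    with that have z: "z q = (\<lambda>_. 0)" by auto
    have "coboundary X z (Suc q) \<sigma> = 0" for \<sigma>
      by (cases "singular_simplex (Suc q) X \<sigma>")
        (simp_all add: coboundary_simplex coboundary_outside z del: sum.atMost_Suc)
    then show ?thesis by (auto simp: Suc)
  qed (simp add: coboundary_def)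
qed (simp add: coboundary_outside)

lemma cup_in_singular_cochains:
  assumes "z \<in> singular_cochains X" "w \<in> singular_cochains X"
  shows "cup X z w \<in> singular_cochains X"
proof (rule singular_cochainsI)
  let ?A = "(\<lambda>(p, q). p + q) ` ({p. z p \<noteq> (\<lambda>_. 0)} \<times> {q. w q \<noteq> (\<lambda>_. 0)})"
  show "finite ?A"
    using assms by (simp add: singular_cochains_finite)
  show "cup X z w n = (\<lambda>_. 0)" if n: "n \<notin> ?A" for n
  proof
    fix \<sigma>
    have "z p \<tau> * w (n - p) \<tau>' = 0" if "p \<le> n" for p \<tau> \<tau>'
    proof -
      have "z p = (\<lambda>_. 0) \<or> w (n - p) = (\<lambda>_. 0)"
        using n that by (force simp: image_iff)
      then show ?thesis by auto
    qed
    then show "cup X z w n \<sigma> = 0" by (simp add: cup_def)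
  qed
qed (simp add: cup_outside)

lemma coboundary_add:
  "coboundary X (\<lambda>p \<sigma>. z p \<sigma> + w p \<sigma>) = (\<lambda>p \<sigma>. coboundary X z p \<sigma> + coboundary X w p \<sigma>)"
  unfolding coboundary_def sum.distrib[symmetric]
  by (intro ext) (auto simp: sum.distrib[symmetric] intro!: sum.cong)

lemma coboundary_minus: "coboundary X (\<lambda>p \<sigma>. - z p \<sigma>) = (\<lambda>p \<sigma>. - coboundary X z p \<sigma>)"
  unfolding coboundary_def
  by (intro ext) (auto simp: sum_negf[symmetric] intro!: sum.cong)

lemma coboundary_zero: "coboundary X (\<lambda>_ _. 0) = (\<lambda>_ _. 0)"
  by (intro ext) (auto simp: coboundary_def intro!: sum.neutral)

text \<open>
  The grading sign carries cocycles to cocycles. That is what makes the coboundaries a left ideal: for a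
  cocycle \<open>x\<close>, the product \<open>x \<union> \<delta>u\<close> is the coboundary of \<open>u\<close> multiplied from the left by \<open>x\<close> with its
  grading signs.
\<close>

lemma coboundary_graded_sign:
  "coboundary X (graded_sign z) = (\<lambda>p \<sigma>. - graded_sign (coboundary X z) p \<sigma>)"
proof (intro ext)
  fix p \<sigma>
  show "coboundary X (graded_sign z) p \<sigma> = - graded_sign (coboundary X z) p \<sigma>"
  proof (cases "singular_simplex p X \<sigma> \<and> p \<noteq> 0")
    case True
    then obtain q where "p = Suc q" by (meson not0_implies_Suc)
    with True show ?thesis
      by (simp add: coboundary_simplex graded_sign_def alternate_sum alternate_plus alternate_minus alternate_commute[of _ q]
          del: sum.atMost_Suc)
  qed (auto simp: coboundary_outside coboundary_deg_0 graded_sign_def)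
qed

lemma graded_sign_graded_sign [simp]: "graded_sign (graded_sign z) = z"
  by (simp add: graded_sign_def)

lemma graded_sign_zero [simp]: "graded_sign (\<lambda>_ _. 0) = (\<lambda>_ _. 0)"
  by (simp add: graded_sign_def)

lemma cup_add_left: "cup X (\<lambda>p \<sigma>. a p \<sigma> + b p \<sigma>) c = (\<lambda>p \<sigma>. cup X a c p \<sigma> + cup X b c p \<sigma>)"
  by (intro ext) (simp add: cup_def distrib_right sum.distrib)

lemma cup_add_right: "cup X c (\<lambda>p \<sigma>. a p \<sigma> + b p \<sigma>) = (\<lambda>p \<sigma>. cup X c a p \<sigma> + cup X c b p \<sigma>)"
  by (intro ext) (simp add: cup_def distrib_left sum.distrib)

lemma cup_zero_left: "cup X (\<lambda>_ _. 0) c = (\<lambda>_ _. 0)"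
  by (intro ext) (simp add: cup_def)

lemma cup_zero_right: "cup X c (\<lambda>_ _. 0) = (\<lambda>_ _. 0)"
  by (intro ext) (simp add: cup_def)

definition unit_cochain :: "'a topology \<Rightarrow> ('a, 'r::{zero, one}) cochain" where
  "unit_cochain X = (\<lambda>p \<sigma>. if p = 0 \<and> singular_simplex 0 X \<sigma> then 1 else 0)"

lemma cup_unit_left:
  fixes z :: "('a, 'r::{comm_ring, comm_monoid_mult}) cochain"
  assumes "z \<in> singular_cochains X"
  shows "cup X (unit_cochain X) z = z"
proof (intro ext)
  fix n \<sigma>
  show "cup X (unit_cochain X) z n \<sigma> = z n \<sigma>"
  proof (cases "singular_simplex n X \<sigma>")
    case True
    have "cup X (unit_cochain X) z n \<sigma> = (\<Sum>p\<le>n. if p = 0 then z n \<sigma> else 0)"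
      unfolding cup_simplex[OF True]
      by (intro sum.cong refl) (use True in \<open>auto simp: unit_cochain_def front_face_simplex back_face_0\<close>)
    then show ?thesis by simp
  qed (simp add: cup_outside singular_cochains_outside[OF assms])
qed

lemma cup_unit_right:
  fixes z :: "('a, 'r::{comm_ring, comm_monoid_mult}) cochain"
  assumes "z \<in> singular_cochains X"
  shows "cup X z (unit_cochain X) = z"
proof (intro ext)
  fix n \<sigma>
  show "cup X z (unit_cochain X) n \<sigma> = z n \<sigma>"
  proof (cases "singular_simplex n X \<sigma>")
    case True
    have "cup X z (unit_cochain X) n \<sigma> = (\<Sum>p\<le>n. if p = n then z n \<sigma> else 0)"
      unfolding cup_simplex[OF True]
      by (intro sum.cong refl)
        (use True back_face_simplex[of n 0 X \<sigma>] in \<open>auto simp: unit_cochain_def front_face_self\<close>)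
    then show ?thesis by simp
  qed (simp add: cup_outside singular_cochains_outside[OF assms])
qed

lemma unit_in_singular_cochains: "unit_cochain X \<in> singular_cochains X"
  by (rule singular_cochainsI[of _ _ "{0}"]) (auto simp: unit_cochain_def)

lemma coboundary_unit: "coboundary X (unit_cochain X :: ('a, 'r::{comm_ring, comm_monoid_mult}) cochain) = (\<lambda>_ _. 0)"
proof (intro ext)
  fix p \<sigma>
  show "coboundary X (unit_cochain X :: ('a, 'r) cochain) p \<sigma> = 0"
  proof (cases "singular_simplex p X \<sigma> \<and> p \<noteq> 0")
    case True
    then obtain q where q: "p = Suc q" by (meson not0_implies_Suc)
    show ?thesis
    proof (cases q)
      case 0
      with True q have "singular_simplex 0 X (singular_face (Suc 0) k \<sigma>)" if "k \<le> Suc 0" for k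
        using singular_simplex_singular_face[of p X \<sigma> k] that by simp
      with True q 0 show ?thesis by (simp add: coboundary_simplex unit_cochain_def)
    next
      case (Suc r)
      with True q show ?thesis by (simp add: coboundary_simplex unit_cochain_def del: sum.atMost_Suc)
    qed
  qed (auto simp: coboundary_outside coboundary_deg_0)
qed

lemma cocycle_ring_simps:
  "carrier (cocycle_ring X) = {z \<in> singular_cochains X. coboundary X z = (\<lambda>_ _. 0)}"
  "z \<otimes>\<^bsub>cocycle_ring X\<^esub> w = cup X z w"
  "\<one>\<^bsub>cocycle_ring X\<^esub> = unit_cochain X"
  "\<zero>\<^bsub>cocycle_ring X\<^esub> = (\<lambda>_ _. 0)"
  "z \<oplus>\<^bsub>cocycle_ring X\<^esub> w = (\<lambda>p \<sigma>. z p \<sigma> + w p \<sigma>)"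
  by (simp_all add: cocycle_ring_def unit_cochain_def)

theorem ring_cocycle_ring:
  "ring (cocycle_ring X :: ('a, 'r::{comm_ring, comm_monoid_mult}) cochain ring)"
proof (rule ringI)
  show "abelian_group (cocycle_ring X :: ('a, 'r) cochain ring)"
  proof (rule abelian_groupI)
    fix z :: "('a, 'r) cochain"
    assume "z \<in> carrier (cocycle_ring X)"
    then show "\<exists>w\<in>carrier (cocycle_ring X). w \<oplus>\<^bsub>cocycle_ring X\<^esub> z = \<zero>\<^bsub>cocycle_ring X\<^esub>"
      by (intro bexI[of _ "\<lambda>p \<sigma>. - z p \<sigma>"])
        (auto simp: cocycle_ring_simps minus_in_singular_cochains coboundary_minus)
  qed (auto simp: cocycle_ring_simps add_in_singular_cochains zero_in_singular_cochains
      coboundary_add coboundary_zero add_ac)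
  show "monoid (cocycle_ring X :: ('a, 'r) cochain ring)"
    by (rule monoidI)
      (auto simp: cocycle_ring_simps cup_in_singular_cochains coboundary_cup cup_zero_left cup_zero_right
        unit_in_singular_cochains coboundary_unit cup_unit_left cup_unit_right cup_assoc)
qed (auto simp: cocycle_ring_simps cup_add_left cup_add_right)

text \<open>
  The Leibniz rule with one factor closed. Hence products of cohomology classes can be computed with any
  representatives.
\<close>

theorem ideal_coboundaries:
  "ideal (coboundaries X) (cocycle_ring X :: ('a, 'r::{comm_ring, comm_monoid_mult}) cochain ring)"
proof (rule idealI[OF ring_cocycle_ring])
  interpret ring "cocycle_ring X :: ('a, 'r) cochain ring" by (rule ring_cocycle_ring)
  show "subgroup (coboundaries X) (add_monoid (cocycle_ring X :: ('a, 'r) cochain ring))"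
  proof (rule add.subgroupI)
    show "coboundaries X \<subseteq> carrier (cocycle_ring X :: ('a, 'r) cochain ring)"
      by (auto simp: coboundaries_def cocycle_ring_simps coboundary_in_singular_cochains coboundary_coboundary)
    show "coboundaries X \<noteq> {}"
      using zero_in_singular_cochains by (auto simp: coboundaries_def)
    fix a b :: "('a, 'r) cochain"
    assume "a \<in> coboundaries X" "b \<in> coboundaries X"
    then obtain u v where u: "u \<in> singular_cochains X" "a = coboundary X u"
      and v: "v \<in> singular_cochains X" "b = coboundary X v" by (auto simp: coboundaries_def)
    have "a \<oplus>\<^bsub>cocycle_ring X\<^esub> b = coboundary X (\<lambda>p \<sigma>. u p \<sigma> + v p \<sigma>)"
      by (simp add: u v coboundary_add cocycle_ring_simps)
    then show "a \<oplus>\<^bsub>cocycle_ring X\<^esub> b \<in> coboundaries X"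
      using u v add_in_singular_cochains by (auto simp: coboundaries_def)
    have "coboundary X (\<lambda>p \<sigma>. - u p \<sigma>) \<oplus>\<^bsub>cocycle_ring X\<^esub> a = \<zero>\<^bsub>cocycle_ring X\<^esub>"
      by (simp add: cocycle_ring_simps coboundary_minus u)
    then have "\<ominus>\<^bsub>cocycle_ring X\<^esub> a = coboundary X (\<lambda>p \<sigma>. - u p \<sigma>)"
      by (rule minus_equality) (simp_all add: cocycle_ring_simps u coboundary_in_singular_cochains
          coboundary_coboundary minus_in_singular_cochains)
    then show "\<ominus>\<^bsub>cocycle_ring X\<^esub> a \<in> coboundaries X"
      using u minus_in_singular_cochains by (auto simp: coboundaries_def)
  qed
  fix a x :: "('a, 'r) cochain"
  assume a: "a \<in> coboundaries X" and x: "x \<in> carrier (cocycle_ring X)"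
  from a obtain u where u: "u \<in> singular_cochains X" "a = coboundary X u" by (auto simp: coboundaries_def)
  from x have x: "x \<in> singular_cochains X" "coboundary X x = (\<lambda>_ _. 0)" by (auto simp: cocycle_ring_simps)
  have "a \<otimes>\<^bsub>cocycle_ring X\<^esub> x = coboundary X (cup X u x)"
    by (simp add: cocycle_ring_simps coboundary_cup u x cup_zero_right)
  then show "a \<otimes>\<^bsub>cocycle_ring X\<^esub> x \<in> coboundaries X"
    using u x by (auto simp: coboundaries_def cup_in_singular_cochains)
  have "x \<otimes>\<^bsub>cocycle_ring X\<^esub> a = coboundary X (cup X (graded_sign x) u)"
    by (simp add: cocycle_ring_simps coboundary_cup u x coboundary_graded_sign cup_zero_left)
  then show "x \<otimes>\<^bsub>cocycle_ring X\<^esub> a \<in> coboundaries X"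
    using u x by (auto simp: coboundaries_def cup_in_singular_cochains graded_sign_in_singular_cochains)
qed

section \<open>Cohomology classes under local sections\<close>

lemma cochain_map_in_singular_cochains:
  assumes "w \<in> singular_cochains E"
  shows "cochain_map X s w \<in> singular_cochains X"
  using assms
  by (intro singular_cochainsI[of _ _ "{p. w p \<noteq> (\<lambda>_. 0)}"])
    (auto simp: cochain_map_def singular_cochains_finite)

lemma coboundary_cochain_map:
  assumes s: "continuous_map X E s"
  shows "coboundary X (cochain_map X s w) = cochain_map X s (coboundary E w)"
proof (intro ext)
  fix p \<sigma>
  show "coboundary X (cochain_map X s w) p \<sigma> = cochain_map X s (coboundary E w) p \<sigma>"
  proof (cases "singular_simplex p X \<sigma> \<and> p \<noteq> 0")
    case True
    then obtain q where q: "p = Suc q" by (meson not0_implies_Suc)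
    have "cochain_map X s w q (singular_face p k \<sigma>) = w q (singular_face p k (simplex_map p s \<sigma>))"
      if "k \<le> p" for k
    proof -
      have "singular_simplex q X (singular_face p k \<sigma>)"
        using singular_simplex_singular_face[of p X \<sigma> k] that True q by simp
      moreover have "simplex_map q s (singular_face p k \<sigma>) = singular_face p k (simplex_map p s \<sigma>)"
        using that by (auto simp: q singular_face_Suc simplex_map_def simplical_face_in_Suc)
      ultimately show ?thesis by (simp add: cochain_map_def)
    qed
    then show ?thesis
      using True singular_simplex_simplex_map[OF _ s, of p \<sigma>] q
      by (simp add: cochain_map_def coboundary_simplex del: sum.atMost_Suc)
  qed (auto simp: cochain_map_def coboundary_outside coboundary_deg_0)
qed

lemma subtopology_singular_cochains:
  "w \<in> singular_cochains (subtopology X V) \<Longrightarrow> w \<in> singular_cochains X"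
  by (auto simp: singular_cochains_def singular_simplex_subtopology)

lemma coboundary_subtopology:
  "singular_simplex p (subtopology X V) \<sigma> \<Longrightarrow> coboundary X w p \<sigma> = coboundary (subtopology X V) w p \<sigma>"
  by (simp add: coboundary_def singular_simplex_subtopology)

text \<open>
  The reason for working with cochains that vanish on the nose over a subspace, and not just with
  classes that restrict to zero: this property passes to products without any exact sequence.
\<close>

lemma cup_vanishes_on_subspace:
  assumes "(\<forall>p \<sigma>. singular_simplex p (subtopology X V) \<sigma> \<longrightarrow> z p \<sigma> = 0) \<or>
      (\<forall>p \<sigma>. singular_simplex p (subtopology X V) \<sigma> \<longrightarrow> w p \<sigma> = 0)"
    and \<sigma>: "singular_simplex n (subtopology X V) \<sigma>"
  shows "cup X z w n \<sigma> = 0"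
proof -
  have "z p (front_face p \<sigma>) * w (n - p) (back_face p (n - p) \<sigma>) = 0" if "p \<le> n" for p
    using assms(1) front_face_simplex[OF \<sigma> that] back_face_simplex[of p "n - p" "subtopology X V" \<sigma>] \<sigma> that
    by auto
  then show ?thesis by (simp add: cup_def)
qed

lemma product_vanishes_on_subspace:
  assumes "z \<in> set zs" "\<And>p \<sigma>. singular_simplex p (subtopology X V) \<sigma> \<Longrightarrow> z p \<sigma> = 0"
    and "singular_simplex n (subtopology X V) \<sigma>"
  shows "foldr (cup X) zs e n \<sigma> = 0"
  using assms(1,3)
proof (induction zs arbitrary: n \<sigma>)
  case (Cons y ys)
  show ?case
  proof (cases "z = y")
    case True
    then show ?thesis using Cons.prems(2) assms(2) by (auto intro!: cup_vanishes_on_subspace)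
  next
    case False
    then show ?thesis
      using Cons by (auto intro!: cup_vanishes_on_subspace[of X V])
  qed
qed simp

lemma (in ideal) foldr_mult_FactRing:
  assumes "set zs \<subseteq> carrier R"
  shows "foldr (\<otimes>\<^bsub>R Quot I\<^esub>) (map ((+>) I) zs) \<one>\<^bsub>R Quot I\<^esub> = I +> foldr (\<otimes>) zs \<one>"
    and "foldr (\<otimes>) zs \<one> \<in> carrier R"
  using assms by (induction zs) (auto simp: FactRing_def rcoset_mult_add)

text \<open>
  If \<open>h\<^sup>*z = \<delta>w\<close>, then \<open>z\<close> restricted to \<open>V\<close> is \<open>s\<^sup>*h\<^sup>*z = \<delta>s\<^sup>*w\<close>. Extending \<open>s\<^sup>*w\<close> by zero to all of \<open>B\<close>
  and subtracting its coboundary gives a representative of the same class that is zero over \<open>V\<close>.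
\<close>

lemma cocycle_vanishing_under_section:
  fixes z :: "('b, 'r::{comm_ring, comm_monoid_mult}) cochain"
  assumes z: "z \<in> carrier (cocycle_ring B)"
    and pullback: "cochain_map E h z \<in> coboundaries E"
    and s: "continuous_map (subtopology B V) E s" "\<And>x. x \<in> V \<Longrightarrow> h (s x) = x"
  obtains z' where "z' \<in> carrier (cocycle_ring B)"
    and "coboundaries B +>\<^bsub>cocycle_ring B\<^esub> z' = coboundaries B +>\<^bsub>cocycle_ring B\<^esub> z"
    and "\<And>p \<sigma>. singular_simplex p (subtopology B V) \<sigma> \<Longrightarrow> z' p \<sigma> = 0"
proof -
  interpret ideal "coboundaries B" "cocycle_ring B :: ('b, 'r) cochain ring" by (rule ideal_coboundaries)
  let ?BV = "subtopology B V"
  obtain w where w: "w \<in> singular_cochains E" "cochain_map E h z = coboundary E w"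
    using pullback unfolding coboundaries_def by (elim imageE) (rule that)
  define w' where "w' = cochain_map ?BV s w"
  define z' where "z' = (\<lambda>p \<sigma>. z p \<sigma> + coboundary B (\<lambda>p \<sigma>. - w' p \<sigma>) p \<sigma>)"
  have w': "w' \<in> singular_cochains B"
    unfolding w'_def by (rule subtopology_singular_cochains[OF cochain_map_in_singular_cochains[OF w(1)]])
  then have mw': "(\<lambda>p \<sigma>. - w' p \<sigma>) \<in> singular_cochains B"
    by (rule minus_in_singular_cochains)
  have "z' p \<sigma> = 0" if \<sigma>: "singular_simplex p ?BV \<sigma>" for p \<sigma>
  proof -
    have s\<sigma>: "singular_simplex p E (simplex_map p s \<sigma>)"
      by (rule singular_simplex_simplex_map[OF \<sigma> s(1)])
    have "simplex_map p h (simplex_map p s \<sigma>) = simplex_map p (h \<circ> s) \<sigma>"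
      by (simp add: simplex_map_compose)
    also have "\<dots> = \<sigma>"
      by (rule simplex_map_id_gen[OF \<sigma>]) (simp add: s(2))
    finally have hs: "simplex_map p h (simplex_map p s \<sigma>) = \<sigma>" .
    have "coboundary B w' p \<sigma> = coboundary ?BV w' p \<sigma>"
      by (rule coboundary_subtopology[OF \<sigma>])
    also have "\<dots> = coboundary E w p (simplex_map p s \<sigma>)"
      unfolding w'_def coboundary_cochain_map[OF s(1)] using \<sigma> by (simp add: cochain_map_def)
    also have "\<dots> = z p \<sigma>"
      using s\<sigma> hs by (simp add: w(2)[symmetric] cochain_map_def)
    finally show ?thesis by (simp add: z'_def coboundary_minus)
  qed
  moreover have z'_coset: "z' \<in> coboundaries B +>\<^bsub>cocycle_ring B\<^esub> z"
  proof -
    have "z' = coboundary B (\<lambda>p \<sigma>. - w' p \<sigma>) \<oplus>\<^bsub>cocycle_ring B\<^esub> z"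
      by (simp add: z'_def cocycle_ring_simps add.commute)
    then show ?thesis
      using mw' by (auto simp: a_r_coset_def' coboundaries_def)
  qed
  moreover have "z' \<in> carrier (cocycle_ring B)"
    using z'_coset z a_r_coset_subset_G[OF a_subset z] by blast
  ultimately show ?thesis
    using that a_repr_independence'[OF z'_coset z] by simp
qed

text \<open>
  The classical cohomological lower bound for the sectional category of a map \<open>h\<close>. Given more than
  \<open>n\<close> classes in the kernel, the factor with index \<open>i \<le> n\<close> gets a representative that vanishes over \<open>V i\<close>. The
  product of the representatives vanishes over every member of the cover, so on all small
  simplices, and is a coboundary.
\<close>

theorem nilpotency_kernel_le_sections:
  fixes B :: "'b topology" and E :: "'e topology" and h :: "'e \<Rightarrow> 'b"
    and R :: "'r::{comm_ring, comm_monoid_mult} itself"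
  assumes V_open: "\<And>i. i \<le> n \<Longrightarrow> openin B (V i)" and V_cover: "topspace B \<subseteq> (\<Union>i\<le>n. V i)"
    and sections: "\<And>i. i \<le> n \<Longrightarrow>
      \<exists>s. continuous_map (subtopology B (V i)) E s \<and> (\<forall>x\<in>V i. h (s x) = x)"
  shows "nilpotency (cohomology_ring R B)
      (a_kernel (cohomology_ring R B) (cohomology_ring R E) (cohomology_map E h)) \<le> enat n"
  unfolding nilpotency_def
proof (rule Sup_least, clarify)
  fix us :: "('b, 'r) cochain set list"
  let ?C = "cocycle_ring B :: ('b, 'r) cochain ring"
  let ?I = "coboundaries B :: ('b, 'r) cochain set"
  assume us: "set us \<subseteq> a_kernel (cohomology_ring R B) (cohomology_ring R E) (cohomology_map E h)"
    and nz: "foldr (\<otimes>\<^bsub>cohomology_ring R B\<^esub>) us \<one>\<^bsub>cohomology_ring R B\<^esub> \<noteq> \<zero>\<^bsub>cohomology_ring R B\<^esub>"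
  interpret ideal ?I ?C by (rule ideal_coboundaries)
  \<comment> \<open>Only the first \<open>n + 1\<close> factors are adapted to the cover; any representative does for the others.\<close>
  have rep: "\<exists>z\<in>carrier ?C. us ! i = ?I +>\<^bsub>?C\<^esub> z \<and>
      (i \<le> n \<longrightarrow> (\<forall>p \<sigma>. singular_simplex p (subtopology B (V i)) \<sigma> \<longrightarrow> z p \<sigma> = 0))"
    if "i < length us" for i
  proof -
    have "us ! i \<in> a_kernel (cohomology_ring R B) (cohomology_ring R E) (cohomology_map E h)"
      using us that by auto
    then obtain z where z: "z \<in> carrier ?C" "us ! i = ?I +>\<^bsub>?C\<^esub> z"
      and zero: "cohomology_map E h (us ! i) = coboundaries E"
      by (auto simp: a_kernel_def' cohomology_ring_def FactRing_def A_RCOSETS_def')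
    have "cochain_map E h z \<in> coboundaries E +>\<^bsub>cocycle_ring E\<^esub> cochain_map E h z"
    proof -
      have "(\<lambda>_ _. 0) \<in> (coboundaries E :: ('e, 'r) cochain set)"
        unfolding coboundaries_def
        by (rule rev_image_eqI[OF zero_in_singular_cochains]) (simp add: coboundary_zero)
      then show ?thesis by (force simp: a_r_coset_def' cocycle_ring_simps)
    qed
    moreover have "z \<in> us ! i"
      using z a_rcos_self by simp
    ultimately have "cochain_map E h z \<in> cohomology_map E h (us ! i)"
      unfolding cohomology_map_def by blast
    then have pullback: "cochain_map E h z \<in> coboundaries E"
      by (simp only: zero)
    show ?thesis
    proof (cases "i \<le> n")
      case True
      then obtain s where "continuous_map (subtopology B (V i)) E s" "\<And>x. x \<in> V i \<Longrightarrow> h (s x) = x"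
        using sections by blast
      then obtain z' where "z' \<in> carrier ?C" "?I +>\<^bsub>?C\<^esub> z' = ?I +>\<^bsub>?C\<^esub> z"
        "\<And>p \<sigma>. singular_simplex p (subtopology B (V i)) \<sigma> \<Longrightarrow> z' p \<sigma> = 0"
        by (rule cocycle_vanishing_under_section[OF z(1) pullback]) blast+
      then show ?thesis using z(2) by auto
    qed (use z in auto)
  qed
  then obtain \<zeta> where \<zeta>: "\<And>i. i < length us \<Longrightarrow> \<zeta> i \<in> carrier ?C"
    "\<And>i. i < length us \<Longrightarrow> us ! i = ?I +>\<^bsub>?C\<^esub> \<zeta> i"
    "\<And>i p \<sigma>. i < length us \<Longrightarrow> i \<le> n \<Longrightarrow> singular_simplex p (subtopology B (V i)) \<sigma> \<Longrightarrow> \<zeta> i p \<sigma> = 0"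
    by metis
  define zs where "zs = map \<zeta> [0..<length us]"
  have us_eq: "us = map ((+>\<^bsub>?C\<^esub>) ?I) zs"
    by (rule nth_equalityI) (auto simp: zs_def \<zeta>(2))
  have zs: "set zs \<subseteq> carrier ?C"
    using \<zeta>(1) by (auto simp: zs_def)
  let ?prod = "foldr (\<otimes>\<^bsub>?C\<^esub>) zs \<one>\<^bsub>?C\<^esub>"
  have prod_carrier: "?prod \<in> carrier ?C"
    by (rule foldr_mult_FactRing(2)[OF zs])
  have "?prod \<notin> ?I"
  proof
    assume "?prod \<in> ?I"
    then have "?I +>\<^bsub>?C\<^esub> ?prod = ?I"
      using a_coset_join2[OF prod_carrier a_subgroup] by simp
    then show False
      using nz foldr_mult_FactRing(1)[OF zs] by (simp add: us_eq cohomology_ring_def FactRing_def)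
  qed
  have "length us \<le> n"
  proof (rule ccontr)
    assume "\<not> length us \<le> n"
    then have len: "i < length us" if "i \<le> n" for i using that by simp
    have "?prod \<in> ?I"
    proof (rule cocycle_zero_on_small_simplices_is_coboundary)
      show "openin B W" if "W \<in> V ` {..n}" for W using that V_open by auto
      show "topspace B \<subseteq> \<Union> (V ` {..n})" using V_cover by simp
      show "?prod \<in> singular_cochains B" "coboundary B ?prod = (\<lambda>_ _. 0)"
        using prod_carrier by (auto simp: cocycle_ring_simps)
      fix p \<sigma> assume "small_simplex p B (V ` {..n}) \<sigma>"
      then obtain i where i: "i \<le> n" "singular_simplex p (subtopology B (V i)) \<sigma>"
        by (auto simp: small_simplex_def)
      have "\<zeta> i \<in> set zs" using len[OF i(1)] by (simp add: zs_def)
      moreover have "(\<otimes>\<^bsub>?C\<^esub>) = cup B" by (intro ext) (simp add: cocycle_ring_simps)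
      ultimately show "?prod p \<sigma> = 0"
        using \<zeta>(3)[OF len[OF i(1)] i(1)] i(2) by (auto intro: product_vanishes_on_subspace)
    qed
    with \<open>?prod \<notin> ?I\<close> show False by simp
  qed
  then show "enat (length us) \<le> enat n" by simp
qed

section \<open>Local sections from equivariant homotopies\<close>

text \<open>
  Half of the exponential law for the compact-open topology. By compactness of \<open>[0,1]\<close>, the projection
  along it is closed; the set of \<open>x\<close> for which some \<open>t \<in> K\<close> has \<open>h (t, x)\<close> outside \<open>V\<close> is the image
  of a closed set under this projection.
\<close>

lemma continuous_map_into_path_space:
  assumes h: "continuous_map (prod_topology (top_of_set {0..1}) Z) Y h"
  shows "continuous_map Z (path_space Y) (\<lambda>x. \<lambda>t\<in>{0..1}. h (t, x))"
  unfolding path_space_def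
proof (rule continuous_on_generated_topo)
  let ?c = "\<lambda>x. \<lambda>t\<in>{0..1}. h (t, x)"
  let ?I = "top_of_set {0..1::real}"
  have path: "?c x \<in> path_set Y" if "x \<in> topspace Z" for x
  proof -
    have "continuous_map ?I Y (h \<circ> (\<lambda>t. (t, x)))"
      using that by (intro continuous_map_compose[OF _ h] continuous_map_pairedI) auto
    then have "continuous_map ?I Y (?c x)"
      by (rule continuous_map_eq) simp
    then show ?thesis by (simp add: path_set_def)
  qed
  have "\<Union> {{\<gamma> \<in> path_set Y. \<gamma> ` K \<subseteq> V} |K V. compact K \<and> K \<subseteq> {0..1} \<and> openin Y V} = path_set Y"
    using topspace_path_space[of Y] unfolding path_space_def topology_generated_by_topspace .
  then show "?c ` topspace Z \<subseteq> \<Union> {{\<gamma> \<in> path_set Y. \<gamma> ` K \<subseteq> V} |K V. compact K \<and> K \<subseteq> {0..1} \<and> openin Y V}"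
    using path by (simp only:) (rule image_subsetI)
  fix W
  assume "W \<in> {{\<gamma> \<in> path_set Y. \<gamma> ` K \<subseteq> V} |K V. compact K \<and> K \<subseteq> {0..1} \<and> openin Y V}"
  then obtain K V where K: "compact K" "K \<subseteq> {0..1}" and V: "openin Y V"
    and W: "W = {\<gamma> \<in> path_set Y. \<gamma> ` K \<subseteq> V}" by auto
  let ?P = "prod_topology ?I Z"
  \<comment> \<open>The pairs at which the condition defining \<open>W\<close> fails; the complement of the preimage of \<open>W\<close> is their projection.\<close>
  let ?B = "{p \<in> topspace ?P. fst p \<in> K} \<inter> {p \<in> topspace ?P. h p \<in> topspace Y - V}"
  have "closedin ?I K"
    using K by (simp add: closed_subset compact_imp_closed)
  then have "closedin ?P ?B"
    using V by (intro closedin_Int closedin_continuous_map_preimage[OF continuous_map_fst]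
        closedin_continuous_map_preimage[OF h]) auto
  moreover have "compact_space ?I"
    by (simp add: compact_space_subtopology)
  ultimately have "closedin Z (snd ` ?B)"
    using Abstract_Topological_Spaces.closed_map_snd unfolding closed_map_def by blast
  moreover have "?c -` W \<inter> topspace Z = topspace Z - snd ` ?B"
  proof -
    have hY: "h (t, x) \<in> topspace Y" if "t \<in> {0..1}" "x \<in> topspace Z" for t x
      using that h by (auto simp: continuous_map_def Pi_iff)
    have "?c x \<in> W \<longleftrightarrow> x \<notin> snd ` ?B" if x: "x \<in> topspace Z" for x
    proof -
      have "?c x \<in> W \<longleftrightarrow> (\<forall>t\<in>K. h (t, x) \<in> V)"
        using path[OF x] K(2) by (auto simp: W image_subset_iff subset_iff)
      also have "\<dots> \<longleftrightarrow> x \<notin> snd ` ?B"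
      proof
        assume *: "\<forall>t\<in>K. h (t, x) \<in> V"
        show "x \<notin> snd ` ?B"
        proof
          assume "x \<in> snd ` ?B"
          then obtain p where p: "p \<in> ?B" "x = snd p" by blast
          then have "fst p \<in> K" "h (fst p, x) \<notin> V" by auto
          with * show False by blast
        qed
      next
        assume *: "x \<notin> snd ` ?B"
        show "\<forall>t\<in>K. h (t, x) \<in> V"
        proof (intro ballI, rule ccontr)
          fix t assume t: "t \<in> K" "h (t, x) \<notin> V"
          with x K(2) hY have "(t, x) \<in> ?B" by auto
          then have "snd (t, x) \<in> snd ` ?B" by (rule imageI)
          with * show False by simp
        qed
      qed
      finally show ?thesis .
    qed
    then show ?thesis by blast
  qed
  ultimately show "openin Z (?c -` W \<inter> topspace Z)" by auto
qed

text \<open>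
  A homotopy \<open>h\<close> over \<open>U\<close> from \<open>f\<close> to \<open>g\<close> gives the section \<open>x \<mapsto> (x, h(-, x))\<close> of the pulled
  back path fibration over \<open>U\<close>. Equivariance of \<open>h\<close> makes the section equivariant, so it descends to
  the orbits. Continuity downstairs holds because the orbit map restricted to the saturated open set
  \<open>U\<close> is still a quotient map.
\<close>

lemma orbit_space_section:
  assumes X: "G_space G T X \<alpha>"
    and U: "openin X U" "invariant_set G \<alpha> U"
    and homotopic: "G_homotopic_on G X \<alpha> Y \<beta> U f g"
  defines "V \<equiv> orbit G \<alpha> ` U"
  shows "openin (orbit_space G X \<alpha>) V"
    and "\<exists>s. continuous_map (subtopology (orbit_space G X \<alpha>) V)
        (orbit_space G (path_pullback X Y f g) (path_pullback_action \<alpha> \<beta>)) s \<and>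
      (\<forall>A\<in>V. orbit_map path_pullback_proj (s A) = A)"
proof -
  interpret group_action G "topspace X" \<alpha>
    using X by (simp add: G_space_def)
  let ?P = "path_pullback X Y f g"
  let ?\<phi> = "path_pullback_action \<alpha> \<beta>"
  have UX: "U \<subseteq> topspace X" using U(1) by (rule openin_subset)
  have pre: "{x \<in> topspace X. orbit G \<alpha> x \<in> V} = U"
  proof
    show "U \<subseteq> {x \<in> topspace X. orbit G \<alpha> x \<in> V}" using UX by (auto simp: V_def)
    show "{x \<in> topspace X. orbit G \<alpha> x \<in> V} \<subseteq> U"
    proof clarify
      fix x assume x: "x \<in> topspace X" "orbit G \<alpha> x \<in> V"
      then obtain y where "y \<in> U" "orbit G \<alpha> x = orbit G \<alpha> y" by (auto simp: V_def)
      moreover from this have "x \<in> orbit G \<alpha> y" using orbit_refl[OF x(1)] by simp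
      ultimately show "x \<in> U"
        using U(2) by (auto simp: orbit_def invariant_set_def)
    qed
  qed
  show V: "openin (orbit_space G X \<alpha>) V"
    unfolding openin_orbit_space pre using U(1) UX by (auto simp: V_def orbits_def)
  obtain h where homotopy: "continuous_map (prod_topology (top_of_set {0..1::real}) (subtopology X U)) Y h \<and>
      (\<forall>x. h (0, x) = f x) \<and> (\<forall>x. h (1, x) = g x) \<and>
      (\<forall>t\<in>{0..1}. equivariant_on G \<alpha> \<beta> U (\<lambda>x. h (t, x)))"
    using homotopic unfolding G_homotopic_on_def homotopic_with_def by blast
  then have h: "continuous_map (prod_topology (top_of_set {0..1}) (subtopology X U)) Y h"
    and h_ends: "\<And>x. h (0, x) = f x" "\<And>x. h (1, x) = g x"
    and equi: "\<forall>t\<in>{0..1}. equivariant_on G \<alpha> \<beta> U (\<lambda>x. h (t, x))"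
    by simp_all
  define s0 where "s0 = (\<lambda>x. (x, \<lambda>t\<in>{0..1}. h (t, x)))"
  define s where "s = (\<lambda>A. s0 ` A)"
  have s0: "continuous_map (subtopology X U) ?P s0"
    unfolding path_pullback_def continuous_map_in_subtopology s0_def
    using continuous_map_into_path_space[OF h]
    by (auto intro!: continuous_map_pairedI simp: path_fibration_def h_ends continuous_map_from_subtopology)
  have s_orbit: "s (orbit G \<alpha> x) = orbit G ?\<phi> (s0 x)" if "x \<in> U" for x
  proof -
    have "s0 (\<alpha> a x) = ?\<phi> a (s0 x)" if "a \<in> carrier G" for a
      using equi that \<open>x \<in> U\<close>
      by (auto simp: s0_def path_pullback_action_def diagonal_action_def path_action_def equivariant_on_def)
    then have "s0 ` {\<alpha> a x |a. a \<in> carrier G} = {?\<phi> a (s0 x) |a. a \<in> carrier G}"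
      unfolding Setcompr_eq_image image_image Collect_mem_eq by (rule image_cong[OF refl])
    then show ?thesis by (simp add: s_def orbit_def)
  qed
  have "quotient_map (subtopology X U) (subtopology (orbit_space G X \<alpha>) V) (orbit G \<alpha>)"
    using quotient_map_restriction[OF quotient_map_orbit pre] V by blast
  moreover have "continuous_map (subtopology X U) (orbit_space G ?P ?\<phi>) (s \<circ> orbit G \<alpha>)"
  proof (rule continuous_map_eq)
    show "continuous_map (subtopology X U) (orbit_space G ?P ?\<phi>) (orbit G ?\<phi> \<circ> s0)"
      by (rule continuous_map_compose[OF s0 quotient_imp_continuous_map[OF quotient_map_orbit]])
  qed (auto simp: s_orbit)
  ultimately have "continuous_map (subtopology (orbit_space G X \<alpha>) V) (orbit_space G ?P ?\<phi>) s"
    by (rule continuous_compose_quotient_map)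
  moreover have "orbit_map path_pullback_proj (s A) = A" for A
    by (simp add: orbit_map_def path_pullback_proj_def s_def s0_def image_image)
  ultimately show "\<exists>s. continuous_map (subtopology (orbit_space G X \<alpha>) V) (orbit_space G ?P ?\<phi>) s \<and>
      (\<forall>A\<in>V. orbit_map path_pullback_proj (s A) = A)" by blast
qed

section \<open>The lower bound for the equivariant homotopic distance\<close>

theorem proposition3p10:
  fixes G :: "('g, 'm) monoid_scheme" and T :: "'g topology"
    and X :: "'a topology" and \<alpha> :: "'g \<Rightarrow> 'a \<Rightarrow> 'a"
    and Y :: "'b topology" and \<beta> :: "'g \<Rightarrow> 'b \<Rightarrow> 'b"
    and f g :: "'a \<Rightarrow> 'b"
    and R :: "'r::{comm_ring, comm_monoid_mult} itself"
  assumes "compact_lie_group G T"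
    and "G_space G T X \<alpha>" and "G_space G T Y \<beta>"
    and "G_map G X \<alpha> Y \<beta> f" and "G_map G X \<alpha> Y \<beta> g"
  shows "equivariant_homotopic_distance G X \<alpha> Y \<beta> f g \<ge>
    (let XG = orbit_space G X \<alpha>;
         PG = orbit_space G (path_pullback X Y f g) (path_pullback_action \<alpha> \<beta>)
     in nilpotency (cohomology_ring R XG)
          (a_kernel (cohomology_ring R XG) (cohomology_ring R PG)
             (cohomology_map PG (orbit_map path_pullback_proj))))"
  unfolding equivariant_homotopic_distance_def Let_def
proof (rule Inf_greatest, clarify)
  fix n and U :: "nat \<Rightarrow> 'a set"
  assume U: "\<forall>i\<le>n. openin X (U i) \<and> invariant_set G \<alpha> (U i) \<and> G_homotopic_on G X \<alpha> Y \<beta> (U i) f g"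
    and cover: "(\<Union>i\<le>n. U i) = topspace X"
  show "nilpotency (cohomology_ring R (orbit_space G X \<alpha>))
      (a_kernel (cohomology_ring R (orbit_space G X \<alpha>))
        (cohomology_ring R (orbit_space G (path_pullback X Y f g) (path_pullback_action \<alpha> \<beta>)))
        (cohomology_map (orbit_space G (path_pullback X Y f g) (path_pullback_action \<alpha> \<beta>))
          (orbit_map path_pullback_proj))) \<le> enat n"
  proof (rule nilpotency_kernel_le_sections[where V = "\<lambda>i. orbit G \<alpha> ` U i"])
    show "topspace (orbit_space G X \<alpha>) \<subseteq> (\<Union>i\<le>n. orbit G \<alpha> ` U i)"
      unfolding topspace_orbit_space orbits_def using cover by blast
    fix i assume "i \<le> n"
    then have Ui: "openin X (U i)" "invariant_set G \<alpha> (U i)" "G_homotopic_on G X \<alpha> Y \<beta> (U i) f g"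
      using U by auto
    show "openin (orbit_space G X \<alpha>) (orbit G \<alpha> ` U i)"
      by (rule orbit_space_section(1)[OF assms(2) Ui])
    show "\<exists>s. continuous_map (subtopology (orbit_space G X \<alpha>) (orbit G \<alpha> ` U i))
        (orbit_space G (path_pullback X Y f g) (path_pullback_action \<alpha> \<beta>)) s \<and>
        (\<forall>A\<in>orbit G \<alpha> ` U i. orbit_map path_pullback_proj (s A) = A)"
      by (rule orbit_space_section(2)[OF assms(2) Ui])
  qed
qed

end
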